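(* There exist a Martin-Löf random real $a\in 2^\omega$ and a non-computable real $b\in 2^\omega$ with $b\le_{tt} a$ such that there is no Martin-Löf random real $y\in 2^\omega$ with $y\le_{wtt} b$.
   Context: Reals are elements of Cantor space $2^\omega$. Martin-Löf randomness is with respect to Lebesgue measure $\lambda$ on $2^\omega$: $x$ is Martin-Löf random if $x\notin\bigcap_i\mathcal U_i$ for every sequence $\{\mathcal U_i\}_{i\in\omega}$ of uniformly effectively open sets with $\lambda(\mathcal U_i)\le 2^{-i}$ for all $i$. $b\le_{tt}a$ means $b=\Phi(a)$ for some Turing functional $\Phi$ that is total on $2^\omega$ (a truth-table functional). $y\le_{wtt}b$ means $y=\Phi(b)$ for some Turing functional $\Phi$ whose use is bounded by a computable function. *)

theory Defs
  imports "HOL-Probability.Probability" "HOL-Library.Nat_Bijection" "HOL-Library.Sublist"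
begin

text \<open>Kleene's partial recursive functions. Programs act on argument lists of any length;
  on lists of a fixed length \<open>n\<close> they denote exactly the \<open>n\<close>-ary partial recursive functions.\<close>

datatype recf = Zero | Succ | Proj nat | Comp recf "recf list" | PrimRec recf recf | Mu recf

inductive eval :: "recf \<Rightarrow> nat list \<Rightarrow> nat \<Rightarrow> bool" where
  eval_Zero: "eval Zero xs 0"
| eval_Succ: "eval Succ (x # xs) (Suc x)"
| eval_Proj: "i < length xs \<Longrightarrow> eval (Proj i) xs (xs ! i)"
| eval_Comp: "list_all2 (\<lambda>g y. eval g xs y) gs ys \<Longrightarrow> eval f ys v \<Longrightarrow> eval (Comp f gs) xs v"
| eval_PrimRec_0: "eval f xs v \<Longrightarrow> eval (PrimRec f g) (0 # xs) v"
| eval_PrimRec_Suc: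
    "eval (PrimRec f g) (n # xs) r \<Longrightarrow> eval g (n # r # xs) v \<Longrightarrow> eval (PrimRec f g) (Suc n # xs) v"
| eval_Mu:
    "eval f (n # xs) 0 \<Longrightarrow> (\<And>m. m < n \<Longrightarrow> \<exists>k. eval f (m # xs) (Suc k)) \<Longrightarrow> eval (Mu f) xs n"

definition computable :: "(nat \<Rightarrow> nat) \<Rightarrow> bool" where
  "computable f \<longleftrightarrow> (\<exists>r. \<forall>n. eval r [n] (f n))"

definition ce :: "nat set \<Rightarrow> bool" where
  "ce A \<longleftrightarrow> (\<exists>r. A = {n. \<exists>v. eval r [n] v})"

type_synonym cantor = "nat \<Rightarrow> bool"

definition computable_real :: "cantor \<Rightarrow> bool" where
  "computable_real x \<longleftrightarrow> computable (\<lambda>n. of_bool (x n))"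

definition initial_segment :: "bool list \<Rightarrow> cantor \<Rightarrow> bool" where
  "initial_segment \<sigma> x \<longleftrightarrow> (\<forall>i<length \<sigma>. \<sigma> ! i = x i)"

definition string_encode :: "bool list \<Rightarrow> nat" where
  "string_encode \<sigma> = list_encode (map of_bool \<sigma>)"

definition cantor_measure :: "cantor measure" where
  "cantor_measure = PiM UNIV (\<lambda>_. uniform_count_measure UNIV)"

definition uniformly_effectively_open :: "(nat \<Rightarrow> cantor set) \<Rightarrow> bool" where
  "uniformly_effectively_open U \<longleftrightarrow>
     (\<exists>W :: (nat \<times> bool list) set.
        ce ((\<lambda>(i, \<sigma>). prod_encode (i, string_encode \<sigma>)) ` W) \<and>
        (\<forall>i. U i = {x. \<exists>\<sigma>. (i, \<sigma>) \<in> W \<and> initial_segment \<sigma> x}))"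

definition ml_random :: "cantor \<Rightarrow> bool" where
  "ml_random x \<longleftrightarrow>
     (\<forall>U. uniformly_effectively_open U \<and> (\<forall>i. measure cantor_measure (U i) \<le> 1 / 2 ^ i)
        \<longrightarrow> x \<notin> (\<Inter>i. U i))"

text \<open>A Turing functional is presented as a c.e. set of pairs of strings: \<open>(\<sigma>, \<tau>) \<in> \<Phi>\<close> means that
  every oracle extending \<open>\<sigma>\<close> yields an output extending \<open>\<tau>\<close>. In general this is a partial map on
  Cantor space, defined at \<open>x\<close> if the outputs obtained from initial segments of \<open>x\<close> are unboundedly
  long.\<close>

definition turing_functional :: "(bool list \<times> bool list) set \<Rightarrow> bool" where
  "turing_functional \<Phi> \<longleftrightarrow>
     ce ((\<lambda>(\<sigma>, \<tau>). prod_encode (string_encode \<sigma>, string_encode \<tau>)) ` \<Phi>) \<and>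
     (\<forall>(\<sigma>, \<tau>) \<in> \<Phi>. \<forall>(\<sigma>', \<tau>') \<in> \<Phi>. prefix \<sigma> \<sigma>' \<longrightarrow> prefix \<tau> \<tau>' \<or> prefix \<tau>' \<tau>)"

text \<open>\<open>\<Phi>(x)\<close> is defined and equal to \<open>y\<close>; such a \<open>y\<close> is unique if \<open>\<Phi>\<close> is a Turing functional.\<close>

definition functional_value :: "(bool list \<times> bool list) set \<Rightarrow> cantor \<Rightarrow> cantor \<Rightarrow> bool" where
  "functional_value \<Phi> x y \<longleftrightarrow>
     (\<forall>n. \<exists>(\<sigma>, \<tau>) \<in> \<Phi>. initial_segment \<sigma> x \<and> initial_segment \<tau> y \<and> n < length \<tau>)"

text \<open>The number of oracle bits of \<open>x\<close> needed to obtain the output bit at position \<open>n\<close>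
  (meaningful only if that bit is defined).\<close>

definition use :: "(bool list \<times> bool list) set \<Rightarrow> cantor \<Rightarrow> nat \<Rightarrow> nat" where
  "use \<Phi> x n = (LEAST k. \<exists>(\<sigma>, \<tau>) \<in> \<Phi>. initial_segment \<sigma> x \<and> n < length \<tau> \<and> length \<sigma> = k)"

definition tt_reducible :: "cantor \<Rightarrow> cantor \<Rightarrow> bool" (infix "\<le>\<^sub>t\<^sub>t" 50) where
  "b \<le>\<^sub>t\<^sub>t a \<longleftrightarrow>
     (\<exists>\<Phi>. turing_functional \<Phi> \<and> (\<forall>x. \<exists>y. functional_value \<Phi> x y) \<and> functional_value \<Phi> a b)"

text \<open>As usual, the use is bounded along the given oracle \<open>b\<close>, not necessarily along all oracles.\<close>

definition wtt_reducible :: "cantor \<Rightarrow> cantor \<Rightarrow> bool" (infix "\<le>\<^sub>w\<^sub>t\<^sub>t" 50) where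
  "y \<le>\<^sub>w\<^sub>t\<^sub>t b \<longleftrightarrow>
     (\<exists>\<Phi> h. turing_functional \<Phi> \<and> functional_value \<Phi> b y \<and>
        computable h \<and> (\<forall>n. use \<Phi> b n \<le> h n))"

end

theory Submission
  imports Defs
begin

text \<open>A left-c.e. Martin-Loef random real \<open>a\<close> is approximated from the left by strings, and no
recursive function bounds the stages at which these approximations settle: if one did, \<open>a\<close> would be
computable. Let \<open>b\<close> record, for every pair \<open>(n, s)\<close>, whether the first \<open>n\<close> bits of the approximation at
stage \<open>s\<close> are those of \<open>a\<close>. These reals are \<open>random_real\<close> and \<open>agreement random_real\<close>.

Each bit of \<open>b\<close> is decided by finitely many bits of \<open>a\<close>, whatever real \<open>a\<close> is, so \<open>b\<close> is truth-table
below \<open>a\<close> (\<open>agreement_tt_reducible\<close>). Searching \<open>b\<close> for stages that have settled recovers \<open>a\<close>, so \<open>b\<close>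
is not computable (\<open>agreement_not_computable\<close>). But \<open>b\<close> unfolds its information very slowly. Let
\<open>y\<close> be obtained from \<open>b\<close> with use bounded by a recursive \<open>h\<close>. For infinitely many \<open>k\<close> the first \<open>k\<close>
bits have not settled by stage \<open>k + h (2 * k)\<close>; then all pairs \<open>(n, s)\<close> with \<open>n \<ge> k\<close> that are coded below
\<open>h (2 * k)\<close> get the value false, and the other ones only depend on the first \<open>k\<close> bits of \<open>a\<close>
(\<open>agreement_string_random_real\<close>). Hence for these \<open>k\<close> the first \<open>2 * k\<close> bits of \<open>y\<close> are computed from one of
the \<open>2 ^ k\<close> strings of length \<open>k\<close>. The set of such \<open>y\<close> has measure at most \<open>2 ^ k / 2 ^ (2 * k)\<close>, and
the unions of the tails form a Martin-Loef test that captures \<open>y\<close>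
(\<open>no_random_wtt_below_agreement\<close>).

The real \<open>a\<close> is the leftmost path outside a universal effectively open set of measure below
one (\<open>ml_random_random_real\<close>). The universal set needs an enumeration of all c.e. sets,
which is provided by a stack machine that evaluates coded programs (\<open>machine_complete\<close>,
\<open>machine_sound\<close>). That the constructions are effective is shown with a
calculus of closure rules for recursive functions between encodable types.\<close>

section \<open>Some partial recursive functions\<close>

lemma eval_Comp1: "eval g xs y \<Longrightarrow> eval f [y] v \<Longrightarrow> eval (Comp f [g]) xs v"
  by (rule eval_Comp[of xs _ "[y]"]) auto

lemma eval_Comp2: "eval g xs y \<Longrightarrow> eval h xs z \<Longrightarrow> eval f [y, z] v \<Longrightarrow> eval (Comp f [g, h]) xs v"
  by (rule eval_Comp[of xs _ "[y, z]"]) auto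

lemma eval_Proj_0: "eval (Proj 0) (x # xs) x"
  using eval_Proj[of 0 "x # xs"] by simp

lemma eval_Proj_1: "eval (Proj 1) (x # y # xs) y"
  using eval_Proj[of 1 "x # y # xs"] by simp

lemma eval_Proj_2: "eval (Proj 2) (x # y # z # xs) z"
  using eval_Proj[of 2 "x # y # z # xs"] by simp

lemma eval_Mu_total:
  assumes "\<And>m. eval f (m # xs) (F m)" and "F n = 0" and "\<And>m. m < n \<Longrightarrow> F m \<noteq> 0"
  shows "eval (Mu f) xs n"
proof (rule eval_Mu)
  show "eval f (n # xs) 0" using assms(1)[of n] assms(2) by simp
  show "\<exists>k. eval f (m # xs) (Suc k)" if "m < n" for m
    using assms(1)[of m] assms(3)[OF that] by (metis not0_implies_Suc)
qed

fun r_const :: "nat \<Rightarrow> recf" where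
  "r_const 0 = Zero"
| "r_const (Suc n) = Comp Succ [r_const n]"

lemma eval_r_const: "eval (r_const n) xs n"
  by (induction n) (auto intro: eval.intros eval_Comp1)

definition "r_add = PrimRec (Proj 0) (Comp Succ [Proj 1])"

lemma eval_r_add: "eval r_add [n, y] (n + y)"
proof (induction n)
  case 0 show ?case by (auto simp: r_add_def intro!: eval_PrimRec_0 eval_Proj_0)
next
  case (Suc n)
  then show ?case unfolding r_add_def add_Suc
    by (blast intro: eval_PrimRec_Suc eval_Comp1 eval_Proj_1 eval_Succ)
qed

definition "r_pred = PrimRec Zero (Proj 0)"

lemma eval_r_pred: "eval r_pred [n] (n - 1)"
  unfolding r_pred_def
  by (induction n) (auto intro: eval_PrimRec_0 eval_Proj_0 eval_PrimRec_Suc eval_Zero)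

definition "r_sub = PrimRec (Proj 0) (Comp r_pred [Proj 1])"

lemma eval_r_sub: "eval r_sub [n, y] (y - n)"
proof (induction n)
  case 0 show ?case by (auto simp: r_sub_def intro!: eval_PrimRec_0 eval_Proj_0)
next
  case (Suc n)
  have "eval r_pred [y - n] (y - Suc n)"
    using eval_r_pred[of "y - n"] by simp
  then show ?case using Suc unfolding r_sub_def by (blast intro: eval_PrimRec_Suc eval_Comp1 eval_Proj_1)
qed

definition "r_triangle = PrimRec Zero (Comp r_add [Proj 1, Comp Succ [Proj 0]])"

lemma eval_r_triangle: "eval r_triangle [n] (triangle n)"
proof (induction n)
  case 0 show ?case by (auto simp: r_triangle_def intro!: eval_PrimRec_0 eval_Zero)
next
  case (Suc n)
  then show ?case
    using eval_r_add[of "triangle n" "Suc n"] unfolding r_triangle_def triangle_Suc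
    by (blast intro: eval_PrimRec_Suc eval_Comp2 eval_Comp1 eval_Proj_1 eval_Proj_0 eval_Succ)
qed

definition "r_pair = Comp r_add [Comp r_triangle [r_add], Proj 0]"

lemma eval_r_pair: "eval r_pair [x, y] (prod_encode (x, y))"
  unfolding r_pair_def prod_encode_def prod.case
  by (rule eval_Comp2 eval_Comp1 eval_r_add eval_r_triangle eval_Proj_0)+

text \<open>The pair coded by \<open>n\<close> lies on the antidiagonal whose number is the least \<open>d\<close> with
  \<open>n < triangle (d + 1)\<close>, and its first component is the offset of \<open>n\<close> on that antidiagonal.\<close>

definition "r_diagonal = Mu (Comp r_sub [Comp r_triangle [Comp Succ [Proj 0]], Comp Succ [Proj 1]])"

lemma triangle_mono: "m \<le> n \<Longrightarrow> triangle m \<le> triangle n"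
  by (induction n rule: nat_induct) (auto simp: le_Suc_eq)

lemma eval_r_diagonal: "eval r_diagonal [prod_encode (x, y)] (x + y)"
  unfolding r_diagonal_def
proof (rule eval_Mu_total)
  fix m
  show "eval (Comp r_sub [Comp r_triangle [Comp Succ [Proj 0]], Comp Succ [Proj 1]])
     [m, prod_encode (x, y)] (Suc (prod_encode (x, y)) - triangle (Suc m))"
    by (rule eval_Comp2 eval_Comp1 eval_r_sub eval_r_triangle eval_Proj_0 eval_Proj_1 eval_Succ)+
next
  show "Suc (prod_encode (x, y)) - triangle (Suc (x + y)) = 0"
    by (simp add: prod_encode_def)
next
  fix m assume "m < x + y"
  then have "triangle (Suc m) \<le> triangle (x + y)" by (intro triangle_mono) simp
  then show "Suc (prod_encode (x, y)) - triangle (Suc m) \<noteq> 0"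
    by (simp add: prod_encode_def del: triangle_Suc)
qed

definition "r_fst = Comp r_sub [Comp r_triangle [r_diagonal], Proj 0]"
definition "r_snd = Comp r_sub [r_fst, r_diagonal]"

lemma eval_r_fst: "eval r_fst [prod_encode (x, y)] x"
proof -
  have "eval r_fst [prod_encode (x, y)] (prod_encode (x, y) - triangle (x + y))"
    unfolding r_fst_def
    by (rule eval_Comp2 eval_Comp1 eval_r_sub eval_r_triangle eval_Proj_0 eval_r_diagonal)+
  then show ?thesis by (simp add: prod_encode_def)
qed

lemma eval_r_snd: "eval r_snd [prod_encode (x, y)] y"
proof -
  have "eval r_snd [prod_encode (x, y)] ((x + y) - x)"
    unfolding r_snd_def
    by (rule eval_Comp2 eval_r_sub eval_r_fst eval_r_diagonal)+
  then show ?thesis by simp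
qed

definition r_if :: "recf \<Rightarrow> recf \<Rightarrow> recf \<Rightarrow> recf" where
  "r_if c t e = Comp (PrimRec e (Comp t [Proj 2])) [c, Proj 0]"

text \<open>Primitive recursion always starts by evaluating its base, so the branch \<open>e\<close> has to converge in any case,
  but \<open>t\<close> may diverge where the condition is \<open>0\<close>. Other values of the condition merely repeat the
  evaluation of \<open>t\<close>.\<close>

lemma eval_r_if:
  assumes "eval c [x] n" and "n \<noteq> 0 \<Longrightarrow> eval t [x] v" and "n = 0 \<Longrightarrow> eval e [x] v"
    and total: "\<exists>w. eval e [x] w"
  shows "eval (r_if c t e) [x] v"
proof -
  have "eval (PrimRec e (Comp t [Proj 2])) [n, x] v"
  proof (cases n)
    case 0
    then show ?thesis using assms(3) by (auto intro: eval_PrimRec_0)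
  next
    case (Suc m)
    then have t: "eval t [x] v" using assms(2) by simp
    obtain w where w: "eval e [x] w" using total by blast
    have "eval (PrimRec e (Comp t [Proj 2])) [Suc k, x] v" for k
      by (induction k) (blast intro: eval_PrimRec_Suc eval_PrimRec_0 eval_Comp1 eval_Proj_2 t w)+
    then show ?thesis using Suc by simp
  qed
  then show ?thesis unfolding r_if_def
    using assms(1) by (blast intro: eval_Comp2 eval_Proj_0)
qed

section \<open>Recursive functions on encoded data\<close>

text \<open>Finite data are coded by natural numbers as in the definition of effectively open
  sets and Turing functionals: Booleans are \<open>0\<close> or \<open>1\<close>, and pairs and lists use the
  standard codings. A typed notion of recursiveness makes it possible to prove that a function is recursive
  from the term that defines it.\<close>

class encodable =
  fixes encode :: "'a \<Rightarrow> nat"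
  assumes inj_encode: "inj encode"

lemma encode_eq_iff [simp]: "encode x = encode y \<longleftrightarrow> x = y"
  by (meson inj_encode injD)

instantiation nat :: encodable
begin
definition encode_nat :: "nat \<Rightarrow> nat" where [simp]: "encode_nat n = n"
instance by standard (simp add: inj_on_def)
end

instantiation bool :: encodable
begin
definition encode_bool :: "bool \<Rightarrow> nat" where [simp]: "encode_bool b = of_bool b"
instance by standard (simp add: inj_on_def)
end

instantiation prod :: (encodable, encodable) encodable
begin
definition encode_prod :: "'a \<times> 'b \<Rightarrow> nat" where
  "encode_prod p = prod_encode (encode (fst p), encode (snd p))"
instance
  by standard (auto simp: inj_on_def encode_prod_def prod_encode_eq)
end

instantiation list :: (encodable) encodable
begin
definition encode_list :: "'a list \<Rightarrow> nat" where
  "encode_list xs = list_encode (map encode xs)"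
instance
  by standard (auto simp: inj_on_def encode_list_def list_encode_eq intro: map_injective inj_encode)
end

definition recursive :: "('a::encodable \<Rightarrow> 'b::encodable) \<Rightarrow> bool" where
  "recursive f \<longleftrightarrow> (\<exists>r. \<forall>x. eval r [encode x] (encode (f x)))"

text \<open>The closure rules are about functions of one argument. A bound variable in the body of a
  recursion, a search or a map becomes a component of a pair, so that the premises of the rules
  have the form \<open>recursive (\<lambda>p. h (fst p) (snd p))\<close>. Inside such a body, a parameter that is known to
  be recursive reappears composed with a projection, which is why \<open>recursive_comp\<close> is needed next to the
  rules.\<close>

named_theorems recursive_intros

lemma recursiveE:
  assumes "recursive f" obtains r where "\<And>x. eval r [encode x] (encode (f x))"
  using assms unfolding recursive_def by blast

lemma recursive_id [recursive_intros]: "recursive (\<lambda>x. x)"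
  unfolding recursive_def by (auto intro: eval_Proj_0)

lemma recursive_const [recursive_intros]: "recursive (\<lambda>x. c)"
  unfolding recursive_def by (auto intro: eval_r_const)

lemma recursive_comp: "recursive f \<Longrightarrow> recursive g \<Longrightarrow> recursive (\<lambda>x. f (g x))"
  unfolding recursive_def by (blast intro: eval_Comp1)

text \<open>Recursiveness only depends on the codes of the values, so that conversions between types whose
  codes agree are recursive.\<close>

lemma recursive_recode: "recursive f \<Longrightarrow> (\<And>x. encode (g x) = encode (f x)) \<Longrightarrow> recursive g"
  unfolding recursive_def by simp

lemma recursive_encode [recursive_intros]: "recursive f \<Longrightarrow> recursive (\<lambda>x. encode (f x))"
  by (erule recursive_recode) simp

lemma recursive_Pair [recursive_intros]:
  "recursive f \<Longrightarrow> recursive g \<Longrightarrow> recursive (\<lambda>x. (f x, g x))"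
  unfolding recursive_def encode_prod_def fst_conv snd_conv by (blast intro: eval_Comp2 eval_r_pair)

lemma recursive_fst [recursive_intros]: "recursive f \<Longrightarrow> recursive (\<lambda>x. fst (f x))"
  unfolding recursive_def encode_prod_def by (blast intro: eval_Comp1 eval_r_fst)

lemma recursive_snd [recursive_intros]: "recursive f \<Longrightarrow> recursive (\<lambda>x. snd (f x))"
  unfolding recursive_def encode_prod_def by (blast intro: eval_Comp1 eval_r_snd)

lemma recursive_comp2:
  "recursive (\<lambda>p. F (fst p) (snd p)) \<Longrightarrow> recursive f \<Longrightarrow> recursive g \<Longrightarrow> recursive (\<lambda>x. F (f x) (g x))"
  using recursive_comp[of "\<lambda>p. F (fst p) (snd p)" "\<lambda>x. (f x, g x)"] recursive_Pair[of f g] by simp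

lemma recursive_comp3:
  "recursive (\<lambda>p. F (fst p) (fst (snd p)) (snd (snd p))) \<Longrightarrow> recursive f \<Longrightarrow> recursive g \<Longrightarrow> recursive h \<Longrightarrow>
    recursive (\<lambda>x. F (f x) (g x) (h x))"
  using recursive_comp[of "\<lambda>p. F (fst p) (fst (snd p)) (snd (snd p))" "\<lambda>x. (f x, g x, h x)"]
    recursive_Pair[of f "\<lambda>x. (g x, h x)"] recursive_Pair[of g h] by simp

lemma recursive_rec_nat [recursive_intros]:
  fixes n :: "'a::encodable \<Rightarrow> nat" and g :: "'a \<Rightarrow> 'b::encodable"
  assumes "recursive n" "recursive g" "recursive (\<lambda>p. h (fst p) (fst (snd p)) (snd (snd p)))"
  shows "recursive (\<lambda>x. rec_nat (g x) (h x) (n x))"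
proof -
  obtain rn where rn: "\<And>x. eval rn [encode x] (encode (n x))"
    using assms(1) by (rule recursiveE) (rule that)
  obtain rg where rg: "\<And>x. eval rg [encode x] (encode (g x))"
    using assms(2) by (rule recursiveE) (rule that)
  obtain rh where rh: "\<And>p. eval rh [encode p] (encode (h (fst p) (fst (snd p)) (snd (snd p))))"
    using assms(3) by (rule recursiveE) (rule that)
  define s where "s = Comp rh [Comp r_pair [Proj 2, Comp r_pair [Proj 0, Proj 1]]]"
  have s: "eval s [k, encode r, encode x] (encode (h x k r))" for k r x
    using rh[of "(x, k, r)"] unfolding s_def
    by (auto simp: encode_prod_def intro: eval_Comp1 eval_Comp2 eval_r_pair eval_Proj_0 eval_Proj_2
        eval_Proj_1[simplified])
  have "eval (PrimRec rg s) [k, encode x] (encode (rec_nat (g x) (h x) k))" for k x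
    by (induction k) (auto intro: eval_PrimRec_0 eval_PrimRec_Suc rg s)
  then have "eval (Comp (PrimRec rg s) [rn, Proj 0]) [encode x] (encode (rec_nat (g x) (h x) (n x)))" for x
    using rn unfolding encode_nat_def by (blast intro: eval_Comp2 eval_Proj_0)
  then show ?thesis unfolding recursive_def by blast
qed

lemma recursive_If [recursive_intros]:
  assumes "recursive P" "recursive f" "recursive g"
  shows "recursive (\<lambda>x. if P x then f x else g x)"
proof -
  have "recursive (\<lambda>x. rec_nat (g x) (\<lambda>_ _. f x) (encode (P x)))"
    using assms(1) by (intro recursive_intros assms recursive_comp[OF assms(2)])
  then show ?thesis
    by (rule recursive_recode) simp
qed

lemma recursive_Least [recursive_intros]:
  fixes P :: "'a::encodable \<Rightarrow> nat \<Rightarrow> bool"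
  assumes "recursive (\<lambda>p. P (fst p) (snd p))" and ex: "\<And>x. \<exists>n. P x n"
  shows "recursive (\<lambda>x. LEAST n. P x n)"
proof -
  have "recursive (\<lambda>p. if P (fst p) (snd p) then 0 else Suc 0)"
    by (intro recursive_intros assms)
  then obtain r where r: "\<And>p. eval r [encode p] (encode (if P (fst p) (snd p) then 0 else Suc 0))"
    by (rule recursiveE) (rule that)
  have "eval (Mu (Comp r [Comp r_pair [Proj 1, Proj 0]])) [encode x] (LEAST n. P x n)" for x
  proof (rule eval_Mu_total)
    fix m
    have "eval (Comp r_pair [Proj 1, Proj 0]) [m, encode x] (encode (x, m))"
      unfolding encode_prod_def fst_conv snd_conv encode_nat_def
      by (rule eval_Comp2 eval_Proj_1 eval_Proj_0 eval_r_pair)+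
    then show "eval (Comp r [Comp r_pair [Proj 1, Proj 0]]) [m, encode x] (if P x m then 0 else Suc 0)"
      using r[of "(x, m)"] by (auto intro: eval_Comp1)
  next
    show "(if P x (LEAST n. P x n) then 0 else Suc 0) = 0" using LeastI_ex[OF ex] by simp
  next
    fix m assume "m < (LEAST n. P x n)"
    then show "(if P x m then 0 else Suc 0) \<noteq> 0" using not_less_Least by auto
  qed
  then show ?thesis unfolding recursive_def encode_nat_def by blast
qed

subsection \<open>Arithmetic and logic\<close>

lemma recursive_Suc [recursive_intros]: "recursive f \<Longrightarrow> recursive (\<lambda>x. Suc (f x))"
  unfolding recursive_def encode_nat_def by (blast intro: eval_Comp1 eval_Succ)

lemma recursive_add [recursive_intros]:
  "recursive f \<Longrightarrow> recursive g \<Longrightarrow> recursive (\<lambda>x. f x + g x :: nat)"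
  unfolding recursive_def encode_nat_def by (blast intro: eval_Comp2 eval_r_add)

lemma recursive_diff [recursive_intros]:
  "recursive f \<Longrightarrow> recursive g \<Longrightarrow> recursive (\<lambda>x. f x - g x :: nat)"
  unfolding recursive_def encode_nat_def by (blast intro: eval_Comp2 eval_r_sub)

lemma recursive_mult [recursive_intros]:
  assumes "recursive f" "recursive g" shows "recursive (\<lambda>x. f x * g x :: nat)"
proof -
  have "n * m = rec_nat 0 (\<lambda>_ r. r + m) n" for n m :: nat
    by (induction n) auto
  then show ?thesis
    by (auto intro!: recursive_intros assms recursive_comp[OF assms(2)])
qed

lemma recursive_power [recursive_intros]:
  assumes "recursive f" "recursive g" shows "recursive (\<lambda>x. f x ^ g x :: nat)"
proof -
  have "m ^ n = rec_nat 1 (\<lambda>_ r. r * m) n" for n m :: nat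
    by (induction n) auto
  then show ?thesis
    by (auto intro!: recursive_intros assms recursive_comp[OF assms(1)])
qed

lemma recursive_eq [recursive_intros]:
  assumes "recursive f" "recursive g" shows "recursive (\<lambda>x. f x = g x)"
proof -
  have "recursive (\<lambda>x. 1 - ((encode (f x) - encode (g x)) + (encode (g x) - encode (f x))))"
    by (intro recursive_intros assms)
  then show ?thesis
  proof (rule recursive_recode)
    fix x show "encode (f x = g x) = encode (1 - ((encode (f x) - encode (g x)) + (encode (g x) - encode (f x))))"
      using encode_eq_iff[of "f x" "g x"] by (cases "f x = g x") (auto simp del: encode_eq_iff)
  qed
qed

lemma recursive_le [recursive_intros]:
  assumes "recursive f" "recursive g" shows "recursive (\<lambda>x. f x \<le> (g x :: nat))"
proof -
  have "recursive (\<lambda>x. f x - g x = 0)" by (intro recursive_intros assms)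
  then show ?thesis by simp
qed

lemma recursive_less [recursive_intros]:
  assumes "recursive f" "recursive g" shows "recursive (\<lambda>x. f x < (g x :: nat))"
  using recursive_le[OF recursive_Suc[OF assms(1)] assms(2)] by (simp add: Suc_le_eq)

lemma recursive_Not [recursive_intros]: "recursive P \<Longrightarrow> recursive (\<lambda>x. \<not> P x)"
  using recursive_If[of P "\<lambda>_. False" "\<lambda>_. True"] by (simp add: recursive_const if_bool_eq_conj)

lemma recursive_conj [recursive_intros]: "recursive P \<Longrightarrow> recursive Q \<Longrightarrow> recursive (\<lambda>x. P x \<and> Q x)"
  using recursive_If[of P Q "\<lambda>_. False"] by (simp add: recursive_const if_bool_eq_disj)

lemma recursive_disj [recursive_intros]: "recursive P \<Longrightarrow> recursive Q \<Longrightarrow> recursive (\<lambda>x. P x \<or> Q x)"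
  using recursive_If[of P "\<lambda>_. True" Q]
  by (simp add: recursive_const if_bool_eq_conj disj_imp)

lemma recursive_Ex_less [recursive_intros]:
  assumes "recursive n" "recursive (\<lambda>p. P (fst p) (snd p))"
  shows "recursive (\<lambda>x. \<exists>i<n x. P x (i :: nat))"
proof -
  have "(\<exists>i<n. Q i) = rec_nat False (\<lambda>i r. r \<or> Q i) n" for n Q
    by (induction n) (auto simp: less_Suc_eq)
  then show ?thesis
    by (auto intro!: recursive_intros assms recursive_comp2[OF assms(2)])
qed

lemma recursive_Ex_le [recursive_intros]:
  assumes "recursive n" "recursive (\<lambda>p. P (fst p) (snd p))"
  shows "recursive (\<lambda>x. \<exists>i\<le>n x. P x (i :: nat))"
  using recursive_Ex_less[OF recursive_Suc[OF assms(1)] assms(2)] by (simp add: less_Suc_eq_le)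

lemma recursive_sum [recursive_intros]:
  fixes f :: "'a::encodable \<Rightarrow> nat \<Rightarrow> nat"
  assumes "recursive n" "recursive (\<lambda>p. f (fst p) (snd p))"
  shows "recursive (\<lambda>x. \<Sum>i<n x. f x i)"
proof -
  have "(\<Sum>i<n. Q i) = rec_nat 0 (\<lambda>i r. r + Q i) n" for n and Q :: "nat \<Rightarrow> nat"
    by (induction n) auto
  then show ?thesis
    by (auto intro!: recursive_intros assms recursive_comp2[OF assms(2)])
qed

lemma recursive_div [recursive_intros]:
  assumes "recursive f" "recursive g" shows "recursive (\<lambda>x. f x div (g x :: nat))"
proof -
  have *: "m < Suc (m div n) * n" if "n \<noteq> 0" for m n :: nat
    using that dividend_less_times_div[of n m] by (simp add: mult.commute)
  have "m div n = (LEAST q. n = 0 \<or> m < Suc q * n)" for m n :: nat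
  proof (rule Least_equality[symmetric])
    show "n = 0 \<or> m < Suc (m div n) * n" using * by blast
    fix q assume "n = 0 \<or> m < Suc q * n"
    then show "m div n \<le> q"
      by (metis div_by_0 le0 less_Suc_eq_le less_mult_imp_div_less)
  qed
  moreover have "recursive (\<lambda>x. LEAST q. g x = 0 \<or> f x < Suc q * g x)"
    by (intro recursive_intros recursive_comp[OF assms(1)] recursive_comp[OF assms(2)]) (use * in blast)
  ultimately show ?thesis by simp
qed

lemma recursive_odd [recursive_intros]:
  fixes f :: "'a::encodable \<Rightarrow> nat"
  assumes "recursive f" shows "recursive (\<lambda>x. odd (f x))"
proof -
  have "recursive (\<lambda>x. \<not> f x div 2 * 2 = f x)" by (intro recursive_intros assms)
  moreover have "(\<not> n div 2 * 2 = n) = odd n" for n :: nat by presburger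
  ultimately show ?thesis by simp
qed

lemma recursive_prod_decode [recursive_intros]:
  "recursive f \<Longrightarrow> recursive (\<lambda>x. prod_decode (f x))"
  by (erule recursive_recode) (simp add: encode_prod_def)

lemma encode_list_decode: "encode (list_decode n) = n"
  by (simp add: encode_list_def id_def[symmetric] encode_nat_def[abs_def])

lemma recursive_list_decode [recursive_intros]:
  "recursive f \<Longrightarrow> recursive (\<lambda>x. list_decode (f x))"
  by (erule recursive_recode) (simp add: encode_list_decode)

subsection \<open>Lists\<close>

lemma encode_Cons: "encode (x # xs) = Suc (encode (x, xs))"
  by (simp add: encode_list_def encode_prod_def)

lemma encode_Nil: "encode [] = 0"
  by (simp add: encode_list_def)

lemma recursive_Cons [recursive_intros]:
  "recursive f \<Longrightarrow> recursive g \<Longrightarrow> recursive (\<lambda>x. f x # g x)"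
  by (rule recursive_recode[of "\<lambda>x. Suc (encode (f x, g x))"])
    (auto intro!: recursive_intros simp: encode_Cons)

text \<open>The head and tail of a list are decoded from the predecessor of its code. For the empty list there is
  nothing to decode and the program for the second branch might diverge, so the lazy conditional is used.\<close>

lemma recursive_case_list [recursive_intros]:
  assumes "recursive l" "recursive g" "recursive (\<lambda>p. h (fst p) (fst (snd p)) (snd (snd p)))"
  shows "recursive (\<lambda>x. case l x of [] \<Rightarrow> g x | y # ys \<Rightarrow> h x y ys)"
proof -
  obtain rl where rl: "\<And>x. eval rl [encode x] (encode (l x))"
    using assms(1) by (rule recursiveE) (rule that)
  obtain rg where rg: "\<And>x. eval rg [encode x] (encode (g x))"
    using assms(2) by (rule recursiveE) (rule that)
  obtain rh where rh: "\<And>p. eval rh [encode p] (encode (h (fst p) (fst (snd p)) (snd (snd p))))"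
    using assms(3) by (rule recursiveE) (rule that)
  let ?t = "Comp rh [Comp r_pair [Proj 0, Comp r_pred [rl]]]"
  have "eval (r_if rl ?t rg) [encode x] (encode (case l x of [] \<Rightarrow> g x | y # ys \<Rightarrow> h x y ys))" for x
  proof (rule eval_r_if[OF rl])
    assume "encode (l x) \<noteq> 0"
    then obtain y ys where l: "l x = y # ys" by (cases "l x") (auto simp: encode_Nil)
    have "eval (Comp r_pred [rl]) [encode x] (encode (y, ys))"
      using rl[of x] eval_r_pred[of "encode (l x)"] by (auto simp: l encode_Cons intro: eval_Comp1)
    then show "eval ?t [encode x] (encode (case l x of [] \<Rightarrow> g x | y # ys \<Rightarrow> h x y ys))"
      using rh[of "(x, y, ys)"] eval_r_pair[of "encode x" "encode (y, ys)"]
      by (auto simp: l encode_prod_def[of "(x, _)"] intro: eval_Comp1 eval_Comp2 eval_Proj_0)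
  next
    assume "encode (l x) = 0"
    then have "l x = []" by (cases "l x") (auto simp: encode_Cons)
    then show "eval rg [encode x] (encode (case l x of [] \<Rightarrow> g x | y # ys \<Rightarrow> h x y ys))"
      using rg by simp
  next
    show "\<exists>w. eval rg [encode x] w" using rg by blast
  qed
  then show ?thesis unfolding recursive_def by blast
qed

text \<open>The code of a list bounds its length, so it can serve as the number of iterations.\<close>

lemma length_le_encode: "length xs \<le> encode xs"
proof (induction xs)
  case (Cons x xs)
  then show ?case
    using le_prod_encode_2[of "encode xs" "encode x"] by (simp add: encode_Cons encode_prod_def)
qed simp

lemma recursive_foldl [recursive_intros]:
  fixes l :: "'a::encodable \<Rightarrow> 'c::encodable list" and a :: "'a \<Rightarrow> 'b::encodable"
  assumes "recursive l" "recursive a" "recursive (\<lambda>p. h (fst p) (fst (snd p)) (snd (snd p)))"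
  shows "recursive (\<lambda>x. foldl (h x) (a x) (l x))"
proof -
  define s where "s x q = (case snd q of [] \<Rightarrow> (fst q, []) | y # ys \<Rightarrow> (h x (fst q) y, ys))" for x q
  have s: "recursive (\<lambda>p. s (fst p) (snd p))"
    unfolding s_def by (intro recursive_intros recursive_comp3[OF assms(3)])
  have shift: "rec_nat (s x q) (\<lambda>_. s x) n = s x (rec_nat q (\<lambda>_. s x) n)" for x q n
    by (induction n) auto
  have *: "rec_nat (b, zs) (\<lambda>_. s x) n = (foldl (h x) b zs, [])" if "length zs \<le> n" for x b zs n
    using that
  proof (induction n arbitrary: b zs)
    case (Suc n)
    show ?case
    proof (cases zs)
      case Nil
      then show ?thesis using Suc.IH[of "[]" b] by (simp add: s_def)
    next
      case (Cons y ys)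
      then show ?thesis
        using Suc.IH[of ys "h x b y"] Suc.prems by (simp add: shift[symmetric]) (simp add: s_def)
    qed
  qed simp
  have "recursive (\<lambda>x. fst (rec_nat (a x, l x) (\<lambda>_. s x) (encode (l x))))"
    by (intro recursive_intros assms recursive_comp2[OF s])
  then show ?thesis by (simp add: * length_le_encode)
qed

lemma recursive_rev [recursive_intros]:
  assumes "recursive l" shows "recursive (\<lambda>x. rev (l x))"
proof -
  have "rev xs = foldl (\<lambda>acc y. y # acc) [] xs" for xs :: "'b list"
    by (simp add: foldl_conv_fold fold_Cons_rev)
  then show ?thesis by (auto intro!: recursive_intros assms)
qed

lemma recursive_append [recursive_intros]:
  assumes "recursive k" "recursive l" shows "recursive (\<lambda>x. k x @ l x)"
proof -
  have "xs @ ys = foldl (\<lambda>acc y. y # acc) ys (rev xs)" for xs ys :: "'b list"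
    by (simp add: foldl_conv_fold fold_Cons_rev)
  then show ?thesis by (auto intro!: recursive_intros assms)
qed

lemma recursive_map [recursive_intros]:
  assumes "recursive l" "recursive (\<lambda>p. f (fst p) (snd p))"
  shows "recursive (\<lambda>x. map (f x) (l x))"
proof -
  have "map g xs = rev (foldl (\<lambda>acc y. g y # acc) [] xs)" for g :: "'b \<Rightarrow> 'c" and xs
    by (induction xs rule: rev_induct) auto
  then show ?thesis by (auto intro!: recursive_intros assms recursive_comp2[OF assms(2)])
qed

lemma recursive_length [recursive_intros]:
  assumes "recursive l" shows "recursive (\<lambda>x. length (l x))"
proof -
  have "length xs = foldl (\<lambda>n _. Suc n) 0 xs" for xs :: "'b list"
    by (induction xs rule: rev_induct) auto
  then show ?thesis by (auto intro!: recursive_intros assms)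
qed

lemma recursive_drop [recursive_intros]:
  assumes "recursive n" "recursive l" shows "recursive (\<lambda>x. drop (n x) (l x))"
proof -
  have "drop k xs = rec_nat xs (\<lambda>_ ys. case ys of [] \<Rightarrow> [] | z # zs \<Rightarrow> zs) k" for k and xs :: "'b list"
    by (induction k) (simp_all add: tl_def[symmetric] drop_Suc tl_drop[symmetric])
  then show ?thesis by (auto intro!: recursive_intros assms)
qed

lemma recursive_take [recursive_intros]:
  assumes "recursive n" "recursive l" shows "recursive (\<lambda>x. take (n x) (l x))"
proof -
  have "take k xs = rev (drop (length xs - k) (rev xs))" for k and xs :: "'b list"
    by (cases "k \<le> length xs") (auto simp: rev_drop)
  then show ?thesis by (auto intro!: recursive_intros assms)
qed

lemma recursive_upt [recursive_intros]:
  assumes "recursive n" shows "recursive (\<lambda>x. [0..<n x])"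
proof -
  have "[0..<k] = rec_nat [] (\<lambda>i r. r @ [i]) k" for k
    by (induction k) auto
  moreover have "recursive (\<lambda>x. rec_nat [] (\<lambda>i r. r @ [i]) (n x))"
    by (intro recursive_intros assms)
  ultimately show ?thesis by simp
qed

lemma computable_iff_recursive: "computable f \<longleftrightarrow> recursive f"
  by (simp add: computable_def recursive_def)

section \<open>A stack machine for partial recursive functions\<close>

fun code :: "recf \<Rightarrow> nat" where
  "code Zero = prod_encode (0, 0)"
| "code Succ = prod_encode (1, 0)"
| "code (Proj i) = prod_encode (2, i)"
| "code (Comp f gs) = prod_encode (3, prod_encode (code f, list_encode (map code gs)))"
| "code (PrimRec f g) = prod_encode (4, prod_encode (code f, code g))"
| "code (Mu f) = prod_encode (5, code f)"

text \<open>A configuration consists of a list of pending tasks and a stack of computed values. A task is a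
  triple: a tag, the code of a program and a list of arguments. The task with tag 0 evaluates the program and pushes
  its value. The other tasks resume a suspended evaluation: tag 1 calls the outer function of a composition
  on the values that have been pushed (here the argument list only serves to count them), tag 2 makes a step of a
  primitive recursion, and tag 3 makes a step of an unbounded search. A single step is a simple function on configurations, so
  its iteration is recursive. Where evaluation is undefined, the step leaves the
  configuration unchanged, so that the machine runs forever.\<close>

type_synonym frame = "nat \<times> nat \<times> nat list"
type_synonym config = "frame list \<times> nat list"

definition start_eval :: "config \<Rightarrow> nat \<Rightarrow> nat list \<Rightarrow> frame list \<Rightarrow> nat list \<Rightarrow> nat \<Rightarrow> nat \<Rightarrow> config" where
  "start_eval c q xs todo vals opr arg =
    (if opr = 0 then (todo, 0 # vals)
     else if opr = 1 then (case xs of [] \<Rightarrow> c | x # _ \<Rightarrow> (todo, Suc x # vals))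
     else if opr = 2 then (case drop arg xs of [] \<Rightarrow> c | x # _ \<Rightarrow> (todo, x # vals))
     else if opr = 3 then
       (map (\<lambda>g. (0, g, xs)) (list_decode (snd (prod_decode arg))) @
         (1, fst (prod_decode arg), list_decode (snd (prod_decode arg))) # todo, vals)
     else if opr = 4 then
       (case xs of [] \<Rightarrow> c
        | n # ys \<Rightarrow> if n = 0 then ((0, fst (prod_decode arg), ys) # todo, vals)
            else ((0, q, (n - 1) # ys) # (2, snd (prod_decode arg), (n - 1) # ys) # todo, vals))
     else if opr = 5 then ((0, arg, 0 # xs) # (3, arg, 0 # xs) # todo, vals)
     else c)"

definition resume :: "config \<Rightarrow> nat \<Rightarrow> nat \<Rightarrow> nat list \<Rightarrow> frame list \<Rightarrow> nat list \<Rightarrow> config" where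
  "resume c tag q xs todo vals =
    (if tag = 1 then ((0, q, rev (take (length xs) vals)) # todo, drop (length xs) vals)
     else case xs of [] \<Rightarrow> c | n # ys \<Rightarrow> case vals of [] \<Rightarrow> c | v # vs \<Rightarrow>
       if tag = 2 then ((0, q, n # v # ys) # todo, vs)
       else if v = 0 then (todo, n # vs)
       else ((0, q, Suc n # ys) # (3, q, Suc n # ys) # todo, vs))"

definition step :: "config \<Rightarrow> config" where
  "step c = (case fst c of [] \<Rightarrow> c | fr # todo \<Rightarrow>
     if fst fr = 0
     then start_eval c (fst (snd fr)) (snd (snd fr)) todo (snd c)
       (fst (prod_decode (fst (snd fr)))) (snd (prod_decode (fst (snd fr))))
     else resume c (fst fr) (fst (snd fr)) (snd (snd fr)) todo (snd c))"

lemma recursive_step: "recursive step"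
  unfolding step_def[abs_def] start_eval_def resume_def by (intro recursive_intros)

definition halted :: "nat \<Rightarrow> config \<Rightarrow> bool" where
  "halted k c \<longleftrightarrow> fst ((step ^^ k) c) = []"

lemma step_halted: "fst c = [] \<Longrightarrow> step c = c"
  by (simp add: step_def)

lemma steps_halted: "fst c = [] \<Longrightarrow> (step ^^ k) c = c"
  by (induction k) (simp_all add: step_halted)

lemma halted_mono: "halted k c \<Longrightarrow> k \<le> l \<Longrightarrow> halted l c"
  using funpow_add[of "l - k" k step] steps_halted[of "(step ^^ k) c" "l - k"] by (simp add: halted_def)

lemma halted_Suc: "halted (Suc k) c = halted k (step c)"
  by (simp add: halted_def funpow_swap1)

lemma not_halted_0: "\<not> halted 0 (fr # todo, vals)"
  by (simp add: halted_def)

lemmas step_simps = step_def start_eval_def resume_def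

lemma step_Comp: "step ((0, code (Comp f gs), xs) # todo, vals) =
    (map (\<lambda>g. (0, code g, xs)) gs @ (1, code f, map code gs) # todo, vals)"
  by (simp add: step_simps comp_def)

lemma step_PrimRec_0: "step ((0, code (PrimRec f g), 0 # xs) # todo, vals) = ((0, code f, xs) # todo, vals)"
  by (simp add: step_simps)

lemma step_PrimRec_Suc: "step ((0, code (PrimRec f g), Suc n # xs) # todo, vals) =
    ((0, code (PrimRec f g), n # xs) # (2, code g, n # xs) # todo, vals)"
  by (simp add: step_simps)

lemma step_Mu: "step ((0, code (Mu f), xs) # todo, vals) =
    ((0, code f, 0 # xs) # (3, code f, 0 # xs) # todo, vals)"
  by (simp add: step_simps)

lemma step_call: "length ys = length gs \<Longrightarrow>
    step ((1, f, gs) # todo, rev ys @ vals) = ((0, f, ys) # todo, vals)"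
  by (simp add: step_simps)

lemma step_PrimRec_frame: "step ((2, g, n # xs) # todo, v # vals) = ((0, g, n # v # xs) # todo, vals)"
  by (simp add: step_simps)

lemma step_Mu_frame: "step ((3, f, n # xs) # todo, v # vals) =
    (if v = 0 then (todo, n # vals) else ((0, f, Suc n # xs) # (3, f, Suc n # xs) # todo, vals))"
  by (simp add: step_simps)

definition reaches :: "config \<Rightarrow> config \<Rightarrow> bool" where
  "reaches c d \<longleftrightarrow> (\<exists>k. (step ^^ k) c = d)"

lemma reaches_refl: "reaches c c"
  unfolding reaches_def by (rule exI[of _ 0]) simp

lemma reaches_trans: "reaches c d \<Longrightarrow> reaches d e \<Longrightarrow> reaches c e"
  unfolding reaches_def by (metis funpow_add o_apply)

lemma reaches_step: "reaches (step c) d \<Longrightarrow> reaches c d"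
  unfolding reaches_def by (metis funpow_Suc_right o_apply)

text \<open>The arguments of a composition are evaluated from left to right, so their values end up on the
  stack in reverse order.\<close>

lemma reaches_args:
  assumes "list_all2 (\<lambda>g y. \<forall>todo vals. reaches ((0, code g, xs) # todo, vals) (todo, y # vals)) gs ys"
  shows "reaches (map (\<lambda>g. (0, code g, xs)) gs @ todo, vals) (todo, rev ys @ vals)"
  using assms
proof (induction arbitrary: vals rule: list_all2_induct)
  case Nil then show ?case by (simp add: reaches_refl)
next
  case (Cons g gs y ys)
  from Cons(1) Cons.IH[of "y # vals"] show ?case by (auto intro: reaches_trans)
qed

text \<open>Evaluation does not look at the pending tasks or at the values below the top of the stack. This generality
  is what makes the induction over the derivation work.\<close>

lemma machine_complete:
  "eval r xs v \<Longrightarrow> reaches ((0, code r, xs) # todo, vals) (todo, v # vals)"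
proof (induction arbitrary: todo vals rule: eval.induct)
  case (eval_Zero xs)
  show ?case by (rule reaches_step) (simp add: step_simps reaches_refl)
next
  case (eval_Succ x xs)
  show ?case by (rule reaches_step) (simp add: step_simps reaches_refl)
next
  case (eval_Proj i xs)
  then have *: "drop i xs = xs ! i # drop (Suc i) xs" by (simp add: Cons_nth_drop_Suc)
  show ?case
    by (rule reaches_step) (simp add: step_simps reaches_refl *)
next
  case (eval_Comp xs gs ys f v)
  have *: "list_all2 (\<lambda>g y. \<forall>todo vals. reaches ((0, code g, xs) # todo, vals) (todo, y # vals)) gs ys"
    using eval_Comp(1) by (rule list_all2_mono) blast
  have len: "length ys = length (map code gs)" using list_all2_lengthD[OF *] by simp
  show ?case
    by (rule reaches_step, unfold step_Comp, rule reaches_trans[OF reaches_args[OF *]],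
        rule reaches_step, unfold step_call[OF len]) (rule eval_Comp.IH)
next
  case (eval_PrimRec_0 f xs v g)
  show ?case by (rule reaches_step, unfold step_PrimRec_0) (rule eval_PrimRec_0.IH)
next
  case (eval_PrimRec_Suc f g n xs r v)
  show ?case
    by (rule reaches_step, unfold step_PrimRec_Suc, rule reaches_trans[OF eval_PrimRec_Suc.IH(1)],
        rule reaches_step, unfold step_PrimRec_frame) (rule eval_PrimRec_Suc.IH(2))
next
  case (eval_Mu f n xs)
  have "reaches ((0, code f, (n - i) # xs) # (3, code f, (n - i) # xs) # todo, vals) (todo, n # vals)"
    if "i \<le> n" for i
    using that
  proof (induction i)
    case 0
    show ?case
      by (simp, rule reaches_trans[OF eval_Mu.IH(1)], rule reaches_step) (simp add: step_Mu_frame reaches_refl)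
  next
    case (Suc i)
    then obtain k where
      k: "\<And>todo vals. reaches ((0, code f, (n - Suc i) # xs) # todo, vals) (todo, Suc k # vals)"
      using eval_Mu.IH(2)[of "n - Suc i"] by auto
    have "Suc (n - Suc i) = n - i" using Suc.prems by simp
    with Suc show ?case
      by (auto simp: step_Mu_frame intro!: reaches_trans[OF k] intro: reaches_step)
  qed
  from this[of n] have "reaches (step ((0, code (Mu f), xs) # todo, vals)) (todo, n # vals)"
    unfolding step_Mu by simp
  then show ?case by (rule reaches_step)
qed

text \<open>The machine is deterministic and rests once no tasks are left, so two evaluations of the same
  program must leave the same final stack.\<close>

lemma eval_deterministic:
  assumes "eval r xs v" "eval r xs w" shows "v = w"
proof -
  let ?c = "([(0, code r, xs)], [])"
  obtain i j where i: "(step ^^ i) ?c = ([], [v])" and j: "(step ^^ j) ?c = ([], [w])"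
    using machine_complete[OF assms(1), of "[]" "[]"] machine_complete[OF assms(2), of "[]" "[]"]
    unfolding reaches_def by blast
  have "(step ^^ (j + i)) ?c = ([], [v])" "(step ^^ (i + j)) ?c = ([], [w])"
    by (simp_all only: funpow_add o_apply i j steps_halted fst_conv)
  then show ?thesis by (simp add: add.commute)
qed

text \<open>A task at the top can only disappear by delivering its value, after which a shorter halting
  run remains. Hence the induction is on the length of the run, and it yields both the evaluation of the
  top task and the remaining run.\<close>

lemma machine_sound:
  "halted k ((0, code r, xs) # todo, vals) \<Longrightarrow> \<exists>v l. l < k \<and> eval r xs v \<and> halted l (todo, v # vals)"
proof (induction k arbitrary: r xs todo vals rule: less_induct)
  case (less k)
  obtain m where k: "k = Suc m" using less.prems not_halted_0 by (cases k) auto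
  have m: "halted m (step ((0, code r, xs) # todo, vals))"
    using less.prems by (simp add: k halted_Suc)
  have stuck: False if "step ((0, code r, xs) # todo, vals) = ((0, code r, xs) # todo, vals)"
  proof -
    have "(step ^^ k) ((0, code r, xs) # todo, vals) = ((0, code r, xs) # todo, vals)"
      by (induction k) (simp_all add: that)
    then show False using less.prems by (simp add: halted_def)
  qed
  show ?case
  proof (cases r)
    case Zero
    then show ?thesis using m by (auto simp: step_simps k intro: eval_Zero)
  next
    case Succ
    show ?thesis
    proof (cases xs)
      case Nil then show ?thesis using stuck by (simp add: Succ step_simps)
    next
      case (Cons x ys)
      then show ?thesis using m by (auto simp: Succ step_simps k intro: eval_Succ)
    qed
  next
    case (Proj i)
    show ?thesis
    proof (cases "i < length xs")
      case False then show ?thesis using stuck by (simp add: Proj step_simps)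
    next
      case True
      then have "drop i xs = xs ! i # drop (Suc i) xs" by (simp add: Cons_nth_drop_Suc)
      then have "halted m (todo, xs ! i # vals)"
        using m by (simp add: Proj step_simps)
      then show ?thesis using True by (auto simp: Proj k intro: eval_Proj)
    qed
  next
    case (Comp f gs)
    \<comment> \<open>The halting run consumes the argument tasks one by one; each of them is shorter than \<open>k\<close>.\<close>
    have args: "\<exists>ys l. l \<le> n \<and> list_all2 (\<lambda>g y. eval g xs y) hs ys \<and> halted l (todo', rev ys @ vals)"
      if "halted n (map (\<lambda>g. (0, code g, xs)) hs @ todo', vals)" "n \<le> m" for n hs todo' vals
      using that
    proof (induction hs arbitrary: n vals)
      case Nil then show ?case by auto
    next
      case (Cons h hs)
      obtain v l where l: "l < n" "eval h xs v"
        "halted l (map (\<lambda>g. (0, code g, xs)) hs @ todo', v # vals)"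
        using less.IH[of n h xs "map (\<lambda>g. (0, code g, xs)) hs @ todo'" vals] Cons.prems k by auto
      obtain ys l' where "l' \<le> l" "list_all2 (\<lambda>g y. eval g xs y) hs ys" "halted l' (todo', rev ys @ v # vals)"
        using Cons.IH[OF l(3)] l(1) Cons.prems(2) by auto
      then show ?case using l by (intro exI[of _ "v # ys"] exI[of _ l']) auto
    qed
    obtain ys l where l: "l \<le> m" "list_all2 (\<lambda>g y. eval g xs y) gs ys"
      "halted l ((1, code f, map code gs) # todo, rev ys @ vals)"
      using args[of m gs "(1, code f, map code gs) # todo" vals] m unfolding Comp step_Comp by blast
    obtain l' where l': "l = Suc l'" using l(3) not_halted_0 by (cases l) auto
    have "halted l' ((0, code f, ys) # todo, vals)"
      using l(3) list_all2_lengthD[OF l(2)] unfolding l' halted_Suc by (subst (asm) step_call) auto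
    then obtain v l'' where "l'' < l'" "eval f ys v" "halted l'' (todo, v # vals)"
      using less.IH[of l' f ys todo vals] l(1) l' k by auto
    then show ?thesis using l l' k
      by (intro exI[of _ v] exI[of _ l'']) (auto simp: Comp intro: eval_Comp)
  next
    case (PrimRec f g)
    show ?thesis
    proof (cases xs)
      case Nil then show ?thesis using stuck by (simp add: PrimRec step_simps)
    next
      case xs: (Cons n ys)
      show ?thesis
      proof (cases n)
        case 0
        then have "halted m ((0, code f, ys) # todo, vals)" using m unfolding PrimRec xs 0 step_PrimRec_0 by simp
        then obtain v l where "l < m" "eval f ys v" "halted l (todo, v # vals)"
          using less.IH[of m f ys todo vals] k by auto
        then show ?thesis using k
          by (intro exI[of _ v] exI[of _ l]) (auto simp: PrimRec xs 0 intro: eval_PrimRec_0)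
      next
        case (Suc n')
        then have "halted m ((0, code (PrimRec f g), n' # ys) # (2, code g, n' # ys) # todo, vals)"
          using m unfolding PrimRec xs Suc step_PrimRec_Suc by simp
        then obtain v l where l: "l < m" "eval (PrimRec f g) (n' # ys) v"
          "halted l ((2, code g, n' # ys) # todo, v # vals)"
          using less.IH[of m "PrimRec f g" "n' # ys" "(2, code g, n' # ys) # todo" vals] k by auto
        obtain l' where l': "l = Suc l'" using l(3) not_halted_0 by (cases l) auto
        have "halted l' ((0, code g, n' # v # ys) # todo, vals)"
          using l(3) by (simp add: l' halted_Suc step_PrimRec_frame)
        then obtain w l'' where "l'' < l'" "eval g (n' # v # ys) w" "halted l'' (todo, w # vals)"
          using less.IH[of l' g "n' # v # ys" todo vals] k l l' by auto
        then show ?thesis using k l l'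
          by (intro exI[of _ w] exI[of _ l'']) (auto simp: PrimRec xs Suc intro: eval_PrimRec_Suc)
      qed
    qed
  next
    case (Mu f)
    \<comment> \<open>The search has failed below \<open>n\<close>; an inner induction follows it until it succeeds.\<close>
    have search: "\<exists>v l'. l' < l \<and> eval (Mu f) xs v \<and> halted l' (todo, v # vals)"
      if "halted l ((0, code f, n # xs) # (3, code f, n # xs) # todo, vals)" "l \<le> m"
        "\<forall>i<n. \<exists>k. eval f (i # xs) (Suc k)" for l n
      using that
    proof (induction l arbitrary: n rule: less_induct)
      case inner: (less l)
      obtain v l1 where l1: "l1 < l" "eval f (n # xs) v" "halted l1 ((3, code f, n # xs) # todo, v # vals)"
        using less.IH[of l f "n # xs" "(3, code f, n # xs) # todo" vals] inner.prems k by auto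
      obtain l2 where l2: "l1 = Suc l2" using l1(3) not_halted_0 by (cases l1) auto
      show ?case
      proof (cases v)
        case 0
        then have "halted l2 (todo, n # vals)" using l1(3) by (simp add: l2 halted_Suc step_Mu_frame)
        moreover have "eval (Mu f) xs n"
          using l1(2) inner.prems(3) by (intro eval_Mu) (auto simp: 0)
        ultimately show ?thesis using l1(1) l2 by (intro exI[of _ n] exI[of _ l2]) auto
      next
        case (Suc v')
        then have "halted l2 ((0, code f, Suc n # xs) # (3, code f, Suc n # xs) # todo, vals)"
          using l1(3) by (simp add: l2 halted_Suc step_Mu_frame)
        moreover have "\<forall>i<Suc n. \<exists>k. eval f (i # xs) (Suc k)"
          using inner.prems(3) l1(2) Suc by (auto simp: less_Suc_eq)
        ultimately obtain w l3 where "l3 < l2" "eval (Mu f) xs w" "halted l3 (todo, w # vals)"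
          using inner.IH[of l2 "Suc n"] l1(1) l2 inner.prems(2) by auto
        then show ?thesis using l1(1) l2 by (intro exI[of _ w] exI[of _ l3]) auto
      qed
    qed
    have "halted m ((0, code f, 0 # xs) # (3, code f, 0 # xs) # todo, vals)"
      using m unfolding Mu step_Mu .
    from search[OF this] show ?thesis unfolding Mu k by (auto intro: less_SucI)
  qed
qed

text \<open>Bounding the number of steps turns the enumeration of the c.e. set with index \<open>e\<close> into a
  decidable relation.\<close>

definition halts :: "nat \<Rightarrow> nat \<Rightarrow> nat \<Rightarrow> bool" where
  "halts e n t \<longleftrightarrow> halted t ([(0, e, [n])], [])"

lemma halts_mono: "halts e n t \<Longrightarrow> t \<le> t' \<Longrightarrow> halts e n t'"
  unfolding halts_def by (rule halted_mono)

lemma recursive_halts [recursive_intros]: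
  assumes "recursive e" "recursive n" "recursive t"
  shows "recursive (\<lambda>x. halts (e x) (n x) (t x))"
proof -
  have "(step ^^ k) c = rec_nat c (\<lambda>_. step) k" for k c
    by (induction k) auto
  then have "halts d m k = (fst (rec_nat ([(0, d, [m])], []) (\<lambda>_. step) k) = [])" for d m k
    by (simp add: halts_def halted_def)
  moreover have "recursive (\<lambda>x. fst (rec_nat ([(0, e x, [n x])], []) (\<lambda>_. step) (t x)) = [])"
    by (intro recursive_intros assms recursive_comp[OF recursive_step])
  ultimately show ?thesis by simp
qed

lemma eval_iff_halts: "(\<exists>v. eval r [n] v) \<longleftrightarrow> (\<exists>t. halts (code r) n t)"
proof
  assume "\<exists>v. eval r [n] v"
  then obtain v where "eval r [n] v" ..
  from machine_complete[OF this, of "[]" "[]"] show "\<exists>t. halts (code r) n t"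
    by (auto simp: reaches_def halts_def halted_def) (metis fst_conv)
next
  assume "\<exists>t. halts (code r) n t"
  then show "\<exists>v. eval r [n] v" using machine_sound unfolding halts_def by blast
qed

lemma ce_halts: "ce A \<Longrightarrow> \<exists>e. A = {n. \<exists>t. halts e n t}"
  unfolding ce_def eval_iff_halts by blast

text \<open>The program for the set searches for an \<open>n\<close> that produces the given code. The search runs over
  parameters rather than over elements of the set, because the programs may diverge on numbers that are not codes.\<close>

lemma ce_encode_image:
  fixes f :: "nat \<Rightarrow> 'a::encodable"
  assumes "recursive f" "recursive P"
  shows "ce (encode ` {f n | n. P n})"
proof -
  define Q where "Q p = (if P (snd p) \<and> encode (f (snd p)) = fst p then 0 else Suc 0)" for p :: "nat \<times> nat"
  have "recursive Q" unfolding Q_def[abs_def]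
    by (intro recursive_intros recursive_comp[OF assms(1)] recursive_comp[OF assms(2)])
  then obtain r where r: "\<And>p. eval r [encode p] (encode (Q p))" by (rule recursiveE) (rule that)
  define s where "s = Comp r [Comp r_pair [Proj 1, Proj 0]]"
  have s: "eval s [n, m] (Q (m, n))" for m n
  proof -
    have "eval (Comp r_pair [Proj 1, Proj 0]) [n, m] (encode (m, n))"
      unfolding encode_prod_def fst_conv snd_conv encode_nat_def
      by (rule eval_Comp2 eval_Proj_1 eval_Proj_0 eval_r_pair)+
    then show ?thesis using r[of "(m, n)"] unfolding s_def by (auto intro: eval_Comp1)
  qed
  have "(\<exists>v. eval (Mu s) [m] v) \<longleftrightarrow> (\<exists>n. Q (m, n) = 0)" for m
  proof
    assume "\<exists>v. eval (Mu s) [m] v"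
    then obtain v where "eval (Mu s) [m] v" ..
    then have "eval s [v, m] 0" by cases
    then show "\<exists>n. Q (m, n) = 0" using s eval_deterministic by metis
  next
    assume ex: "\<exists>n. Q (m, n) = 0"
    have "eval (Mu s) [m] (LEAST n. Q (m, n) = 0)"
      by (rule eval_Mu_total[where F = "\<lambda>n. Q (m, n)"]) (use s LeastI_ex[OF ex] not_less_Least in auto)
    then show "\<exists>v. eval (Mu s) [m] v" by blast
  qed
  moreover have "encode ` {f n | n. P n} = {m. \<exists>n. Q (m, n) = 0}"
    by (auto simp: Q_def)
  ultimately show ?thesis unfolding ce_def by (intro exI[of _ "Mu s"]) simp
qed

section \<open>Strings, cylinders and their measure\<close>

text \<open>The \<open>v\<close>-th string of length \<open>n\<close> in lexicographic order: the binary expansion of \<open>v\<close>, most significant bit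
  first. With this coding, comparing strings from the left is comparing numbers, and
  taking a prefix is dividing by a power of two.\<close>

definition bits :: "nat \<Rightarrow> nat \<Rightarrow> bool list" where
  "bits n v = map (\<lambda>i. odd (v div 2 ^ (n - Suc i))) [0..<n]"

lemma length_bits [simp]: "length (bits n v) = n"
  by (simp add: bits_def)

lemma div_power_div: "k \<le> m \<Longrightarrow> m \<le> n \<Longrightarrow> v div 2 ^ (n - m) div 2 ^ (m - k) = v div 2 ^ (n - k)" for v :: nat
  by (simp add: div_mult2_eq[symmetric] power_add[symmetric])

lemma take_bits: "m \<le> n \<Longrightarrow> take m (bits n v) = bits m (v div 2 ^ (n - m))"
  by (rule nth_equalityI) (simp_all add: bits_def div_power_div)

lemma bits_surj: "bits n ` {..<2 ^ n} = {\<sigma>. length \<sigma> = n}"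
proof
  show "{\<sigma>. length \<sigma> = n} \<subseteq> bits n ` {..<2 ^ n}"
  proof safe
    fix \<sigma> :: "bool list"
    show "\<sigma> \<in> bits (length \<sigma>) ` {..<2 ^ length \<sigma>}"
    proof (induction \<sigma> rule: rev_induct)
      case (snoc b \<sigma>)
      then obtain v where v: "v < 2 ^ length \<sigma>" "bits (length \<sigma>) v = \<sigma>" by auto
      have "bits (Suc (length \<sigma>)) (2 * v + of_bool b) = \<sigma> @ [b]"
      proof (rule nth_equalityI)
        fix i assume i: "i < length (bits (Suc (length \<sigma>)) (2 * v + of_bool b))"
        show "bits (Suc (length \<sigma>)) (2 * v + of_bool b) ! i = (\<sigma> @ [b]) ! i"
        proof (cases "i = length \<sigma>")
          case False
          then have i: "i < length \<sigma>" using i by simp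
          have "\<sigma> ! i = odd (v div 2 ^ (length \<sigma> - Suc i))"
            using i by (subst v(2)[symmetric]) (simp add: bits_def)
          moreover have "(2 * v + of_bool b) div 2 = v" by (cases b) auto
          then have "(2 * v + of_bool b) div 2 ^ (length \<sigma> - i) = v div 2 ^ (length \<sigma> - Suc i)"
            using i by (simp add: div_mult2_eq Suc_diff_Suc[symmetric])
          ultimately show ?thesis using i by (simp add: bits_def nth_append del: upt_Suc)
        qed (simp add: bits_def nth_append del: upt_Suc)
      qed simp
      moreover have "2 * v + of_bool b < 2 ^ Suc (length \<sigma>)" using v(1) by (cases b) auto
      ultimately show ?case by (auto intro!: image_eqI[of _ _ "2 * v + of_bool b"])
    qed (simp add: bits_def)
  qed
qed auto

lemma card_strings: "card {\<sigma> :: bool list. length \<sigma> = n} = 2 ^ n"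
  using card_lists_length_eq[of "UNIV :: bool set" n] by simp

lemma finite_strings: "finite {\<sigma> :: bool list. length \<sigma> = n}"
  using finite_lists_length_eq[of "UNIV :: bool set" n] by simp

lemma inj_on_bits: "inj_on (bits n) {..<2 ^ n}"
  by (rule eq_card_imp_inj_on) (simp_all add: bits_surj card_strings)

lemma recursive_bits [recursive_intros]:
  assumes "recursive n" "recursive v" shows "recursive (\<lambda>x. bits (n x) (v x))"
  unfolding bits_def
  by (intro recursive_intros assms recursive_comp[OF assms(1)] recursive_comp[OF assms(2)])

definition pre :: "cantor \<Rightarrow> nat \<Rightarrow> bool list" where
  "pre x n = map x [0..<n]"

lemma length_pre [simp]: "length (pre x n) = n"
  by (simp add: pre_def)

lemma take_pre: "m \<le> n \<Longrightarrow> take m (pre x n) = pre x m"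
  by (simp add: pre_def take_map)

lemma initial_segment_iff: "initial_segment \<sigma> x \<longleftrightarrow> pre x (length \<sigma>) = \<sigma>"
  by (subst list_eq_iff_nth_eq) (auto simp: initial_segment_def pre_def)

definition cylinder :: "bool list \<Rightarrow> cantor set" where
  "cylinder \<sigma> = {x. initial_segment \<sigma> x}"

lemma prob_space_coin: "prob_space (uniform_count_measure (UNIV :: bool set))"
  by (simp add: prob_space_uniform_count_measure)

lemma prob_space_cantor_measure: "prob_space cantor_measure"
  unfolding cantor_measure_def by (rule prob_space_PiM) (rule prob_space_coin)

interpretation cantor: prob_space cantor_measure
  by (rule prob_space_cantor_measure)

lemma cylinder_eq_emb:
  "cylinder \<sigma> = prod_emb UNIV (\<lambda>_. uniform_count_measure UNIV) {..<length \<sigma>} (\<Pi>\<^sub>E i\<in>{..<length \<sigma>}. {\<sigma> ! i})"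
proof (rule set_eqI)
  fix x :: cantor
  have "x \<in> prod_emb UNIV (\<lambda>_. uniform_count_measure UNIV) {..<length \<sigma>} (\<Pi>\<^sub>E i\<in>{..<length \<sigma>}. {\<sigma> ! i}) \<longleftrightarrow>
      (\<forall>i<length \<sigma>. x i = \<sigma> ! i)"
    by (simp add: prod_emb_iff space_uniform_count_measure PiE_iff Ball_def)
  then show "x \<in> cylinder \<sigma> \<longleftrightarrow>
      x \<in> prod_emb UNIV (\<lambda>_. uniform_count_measure UNIV) {..<length \<sigma>} (\<Pi>\<^sub>E i\<in>{..<length \<sigma>}. {\<sigma> ! i})"
    by (simp only: cylinder_def initial_segment_def mem_Collect_eq) metis
qed

lemma cylinder_measurable [measurable]: "cylinder \<sigma> \<in> sets cantor_measure"
  unfolding cylinder_eq_emb cantor_measure_def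
  by (intro sets_PiM_I) (auto simp: sets_uniform_count_measure)

lemma measure_cylinder: "measure cantor_measure (cylinder \<sigma>) = 1 / 2 ^ length \<sigma>"
proof -
  have "emeasure cantor_measure (cylinder \<sigma>) =
      (\<Prod>i<length \<sigma>. emeasure (uniform_count_measure UNIV) {\<sigma> ! i})"
    unfolding cylinder_eq_emb cantor_measure_def
    by (rule product_prob_space.emeasure_PiM_emb[OF product_prob_spaceI[OF prob_space_coin]])
      (auto simp: sets_uniform_count_measure)
  also have "\<dots> = (\<Prod>i<length \<sigma>. ennreal (1 / 2))"
    by (simp add: emeasure_uniform_count_measure)
  also have "\<dots> = ennreal (1 / 2 ^ length \<sigma>)"
    by (subst prod_ennreal) (simp_all add: power_one_over)
  finally show ?thesis by (simp add: measure_def)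
qed

lemma Union_cylinders_measurable: "(\<Union>\<sigma>\<in>S. cylinder \<sigma>) \<in> sets cantor_measure"
  by (intro sets.countable_UN'') auto

lemma measure_Union_cylinders:
  assumes "S \<subseteq> {\<sigma>. length \<sigma> = n}"
  shows "measure cantor_measure (\<Union>\<sigma>\<in>S. cylinder \<sigma>) = card S / 2 ^ n"
proof -
  have "finite S" using assms finite_strings finite_subset by blast
  moreover have "disjoint_family_on cylinder S"
    using assms unfolding disjoint_family_on_def cylinder_def initial_segment_iff
    by (smt (verit) disjoint_iff mem_Collect_eq subsetD)
  ultimately have "measure cantor_measure (\<Union>\<sigma>\<in>S. cylinder \<sigma>) = (\<Sum>\<sigma>\<in>S. measure cantor_measure (cylinder \<sigma>))"
    by (intro cantor.finite_measure_finite_Union) auto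
  also have "\<dots> = (\<Sum>\<sigma>\<in>S. 1 / 2 ^ n)"
    using assms by (intro sum.cong) (auto simp: measure_cylinder)
  finally show ?thesis by simp
qed

lemma string_encode_eq: "string_encode = encode"
  by (rule ext) (simp add: string_encode_def encode_list_def encode_bool_def[abs_def])

lemma encode_pair_eq: "(\<lambda>(i, \<sigma>). prod_encode (i, string_encode \<sigma>)) = encode"
  by (rule ext) (simp add: string_encode_eq encode_prod_def split: prod.split)

lemma encode_strings_eq: "(\<lambda>(\<sigma>, \<tau>). prod_encode (string_encode \<sigma>, string_encode \<tau>)) = encode"
  by (rule ext) (simp add: string_encode_eq encode_prod_def split: prod.split)

section \<open>A left-c.e. random real\<close>

text \<open>Component \<open>e + 2\<close> of the test with index \<open>e\<close> has measure at most \<open>1 / 2 ^ (e + 2)\<close>, so that all these components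
  together leave something uncovered. A string is enumerated if one of its
  prefixes has been put into this component within as many steps as the string is long. This is decidable, it is
  inherited by extensions, and it is eventually true along every real in the component.\<close>

definition enumerated :: "nat \<Rightarrow> bool list \<Rightarrow> bool" where
  "enumerated e \<tau> \<longleftrightarrow> (\<exists>m\<le>length \<tau>. halts e (encode (e + 2, take m \<tau>)) (length \<tau>))"

lemma enumerated_take: "enumerated e (take k \<tau>) \<Longrightarrow> enumerated e \<tau>"
proof -
  assume "enumerated e (take k \<tau>)"
  then obtain m where m: "m \<le> length (take k \<tau>)"
    "halts e (encode (e + 2, take m (take k \<tau>))) (length (take k \<tau>))"
    unfolding enumerated_def by blast
  from m(1) have "take m (take k \<tau>) = take m \<tau>" by (simp add: min.absorb1)
  with m show ?thesis
    unfolding enumerated_def by (intro exI[of _ m]) (auto intro: halts_mono)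
qed

text \<open>Not every index belongs to a Martin-Loef test. Strings of length \<open>n\<close> are only used while their number respects the
  bound on the measure; for an actual test this is always the case.\<close>

definition small :: "nat \<Rightarrow> nat \<Rightarrow> bool" where
  "small e n \<longleftrightarrow> card {v. v < 2 ^ n \<and> enumerated e (bits n v)} * 2 ^ (e + 2) \<le> 2 ^ n"

definition covered :: "nat \<Rightarrow> nat \<Rightarrow> bool" where
  "covered n v \<longleftrightarrow> (\<exists>m\<le>n. \<exists>e\<le>n. small e m \<and> enumerated e (bits m (v div 2 ^ (n - m))))"

lemma covered_extend: "covered m (v div 2 ^ (n - m)) \<Longrightarrow> m \<le> n \<Longrightarrow> covered n v"
proof -
  assume "covered m (v div 2 ^ (n - m))" and "m \<le> n"
  then obtain k e where k: "k \<le> m" "e \<le> m" "small e k"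
    "enumerated e (bits k (v div 2 ^ (n - m) div 2 ^ (m - k)))"
    unfolding covered_def by blast
  then have "enumerated e (bits k (v div 2 ^ (n - k)))"
    using \<open>m \<le> n\<close> by (simp add: div_power_div)
  with k \<open>m \<le> n\<close> show ?thesis
    unfolding covered_def by (intro exI[of _ k] exI[of _ e] conjI) auto
qed

lemma recursive_enumerated [recursive_intros]:
  assumes "recursive e" "recursive \<tau>" shows "recursive (\<lambda>x. enumerated (e x) (\<tau> x))"
  unfolding enumerated_def
  by (intro recursive_intros assms recursive_comp[OF assms(1)] recursive_comp[OF assms(2)])

lemma recursive_small [recursive_intros]:
  assumes "recursive e" "recursive n" shows "recursive (\<lambda>x. small (e x) (n x))"
proof -
  have "card {v. v < N \<and> Q v} = (\<Sum>v<N. if Q v then 1 else 0)" for N and Q :: "nat \<Rightarrow> bool"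
    by (simp add: sum.If_cases Collect_conj_eq lessThan_def[symmetric])
  moreover have "recursive (\<lambda>x. (\<Sum>v<2 ^ n x. if enumerated (e x) (bits (n x) v) then 1 else 0) * 2 ^ (e x + 2) \<le> (2 ^ n x :: nat))"
    by (intro recursive_intros assms recursive_comp[OF assms(1)] recursive_comp[OF assms(2)])
  ultimately show ?thesis by (simp add: small_def)
qed

lemma recursive_covered [recursive_intros]:
  assumes "recursive n" "recursive v" shows "recursive (\<lambda>x. covered (n x) (v x))"
  unfolding covered_def
  by (intro recursive_intros assms recursive_comp[OF assms(1)] recursive_comp[OF assms(2)])

text \<open>Since enumerated strings only grow with the length, all strings that index \<open>e\<close> covers extend one of those
  at the last length where their number was small.\<close>

lemma card_covered_by:
  "card {v. v < 2 ^ n \<and> (\<exists>m\<le>n. small e m \<and> enumerated e (bits m (v div 2 ^ (n - m))))} * 2 ^ (e + 2) \<le> 2 ^ n"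
    (is "card ?C * _ \<le> _")
proof (cases "\<exists>m\<le>n. small e m")
  case False
  then have empty: "?C = {}" by auto
  show ?thesis unfolding empty by simp
next
  case True
  define M where "M = Max {m. m \<le> n \<and> small e m}"
  have fin: "finite {m. m \<le> n \<and> small e m}" by simp
  have M: "M \<le> n" "small e M" using Max_in[OF fin] True by (auto simp: M_def)
  have max: "m \<le> M" if "m \<le> n" "small e m" for m using Max_ge[OF fin] that by (simp add: M_def)
  define E where "E = {w. w < 2 ^ M \<and> enumerated e (bits M w)}"
  have "?C \<subseteq> (\<Union>w\<in>E. {w * 2 ^ (n - M)..<Suc w * 2 ^ (n - M)})"
  proof safe
    fix v m assume v: "v < 2 ^ n" and m: "m \<le> n" "small e m" "enumerated e (bits m (v div 2 ^ (n - m)))"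
    have "bits m (v div 2 ^ (n - m)) = take m (bits M (v div 2 ^ (n - M)))"
      using max[OF m(1,2)] M(1) by (simp add: take_bits div_power_div)
    then have "enumerated e (bits M (v div 2 ^ (n - M)))" using m(3) enumerated_take by metis
    moreover have "v div 2 ^ (n - M) < 2 ^ M"
      using v M(1) by (simp add: less_mult_imp_div_less power_add[symmetric])
    ultimately have "v div 2 ^ (n - M) \<in> E" by (simp add: E_def)
    moreover have "v < Suc (v div 2 ^ (n - M)) * 2 ^ (n - M)"
      using dividend_less_times_div[of "2 ^ (n - M)" v] by (simp add: mult.commute)
    ultimately show "v \<in> (\<Union>w\<in>E. {w * 2 ^ (n - M)..<Suc w * 2 ^ (n - M)})"
      by (auto intro!: bexI[of _ "v div 2 ^ (n - M)"])
  qed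
  moreover have "finite E" by (simp add: E_def)
  ultimately have "card ?C \<le> card (\<Union>w\<in>E. {w * 2 ^ (n - M)..<Suc w * 2 ^ (n - M)})"
    by (intro card_mono) auto
  also have "\<dots> \<le> (\<Sum>w\<in>E. card {w * 2 ^ (n - M)..<Suc w * 2 ^ (n - M)})"
    using \<open>finite E\<close> by (rule card_UN_le)
  also have "\<dots> = card E * 2 ^ (n - M)" by simp
  finally have "card ?C * 2 ^ (e + 2) \<le> (card E * 2 ^ (e + 2)) * 2 ^ (n - M)"
    by (simp add: mult_ac)
  also have "\<dots> \<le> 2 ^ M * 2 ^ (n - M)"
    using M(2) unfolding small_def E_def by (rule mult_le_mono1)
  also have "\<dots> = 2 ^ n" using M(1) by (simp add: power_add[symmetric])
  finally show ?thesis .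
qed

text \<open>The fractions that the single indices cover are at most \<open>1 / 2 ^ (e + 2)\<close> and so add up to less than \<open>1 / 2\<close>.\<close>

lemma ex_not_covered: "\<exists>v<2 ^ n. \<not> covered n v"
proof -
  define C where "C e = {v. v < 2 ^ n \<and> (\<exists>m\<le>n. small e m \<and> enumerated e (bits m (v div 2 ^ (n - m))))}" for e
  have C: "real (card (C e)) \<le> 2 ^ n * (1 / 2 ^ (e + 2))" for e
  proof -
    have "real (card (C e) * 2 ^ (e + 2)) \<le> real (2 ^ n)"
      using card_covered_by[of n e] unfolding C_def[symmetric] of_nat_le_iff .
    then show ?thesis by (simp add: field_simps)
  qed
  have "real (card (\<Union>e\<le>n. C e)) \<le> (\<Sum>e\<le>n. real (card (C e)))"
    using card_UN_le[of "{..n}" C] by (simp flip: of_nat_sum)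
  also have "\<dots> \<le> 2 ^ n * (\<Sum>e\<le>n. 1 / 2 ^ (e + 2))"
    unfolding sum_distrib_left by (intro sum_mono C)
  also have "(\<Sum>e\<le>n. 1 / 2 ^ (e + 2)) = (1 / 2 - 1 / 2 ^ (n + 2) :: real)"
    by (induction n) (auto simp: field_simps)
  also have "2 ^ n * \<dots> < (2 ^ n :: real)"
    by (simp add: field_simps power_add add_pos_pos)
  finally have "card (\<Union>e\<le>n. C e) < card {..<2 ^ n :: nat}" by simp
  then have "\<not> {..<2 ^ n} \<subseteq> (\<Union>e\<le>n. C e)"
    using card_mono[of "\<Union>e\<le>n. C e" "{..<2 ^ n}"] by (auto simp: C_def)
  then show ?thesis by (auto simp: C_def covered_def)
qed

text \<open>The leftmost uncovered string of length \<open>n\<close>. As \<open>n\<close> grows it can only move to the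
  right, since all extensions of covered strings are covered.\<close>

definition leftmost :: "nat \<Rightarrow> nat" where
  "leftmost n = (LEAST v. \<not> covered n v)"

lemma recursive_leftmost [recursive_intros]:
  assumes "recursive n" shows "recursive (\<lambda>x. leftmost (n x))"
  unfolding leftmost_def
  by (intro recursive_intros assms recursive_comp[OF assms]) (use ex_not_covered in blast)

lemma leftmost_not_covered: "\<not> covered n (leftmost n)"
  unfolding leftmost_def using ex_not_covered by (metis (mono_tags, lifting) LeastI)

lemma leftmost_less: "leftmost n < 2 ^ n"
proof -
  obtain v where "v < 2 ^ n" "\<not> covered n v" using ex_not_covered by blast
  then show ?thesis unfolding leftmost_def using Least_le[of "\<lambda>v. \<not> covered n v" v] by simp
qed

lemma leftmost_le: "m \<le> n \<Longrightarrow> leftmost m \<le> leftmost n div 2 ^ (n - m)"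
  unfolding leftmost_def[of m]
  by (rule Least_le) (use covered_extend leftmost_not_covered in blast)

text \<open>The number of the length-\<open>k\<close> prefix of the leftmost uncovered string of length \<open>n\<close>, for \<open>k \<le> n\<close>.\<close>

definition approx :: "nat \<Rightarrow> nat \<Rightarrow> nat" where
  "approx k n = leftmost n div 2 ^ (n - k)"

lemma approx_mono: "k \<le> m \<Longrightarrow> m \<le> n \<Longrightarrow> approx k m \<le> approx k n"
  unfolding approx_def using div_le_mono[OF leftmost_le[of m n], of "2 ^ (m - k)"] by (simp add: div_power_div)

lemma approx_less: "k \<le> n \<Longrightarrow> approx k n < 2 ^ k"
  unfolding approx_def using leftmost_less[of n] by (simp add: less_mult_imp_div_less power_add[symmetric])

lemma approx_div: "m \<le> k \<Longrightarrow> k \<le> n \<Longrightarrow> approx k n div 2 ^ (k - m) = approx m n"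
  unfolding approx_def by (rule div_power_div)

lemma bits_approx: "k \<le> n \<Longrightarrow> bits k (approx k n) = take k (bits n (leftmost n))"
  unfolding approx_def by (simp add: take_bits)

text \<open>The approximations of the first \<open>k\<close> bits increase and are bounded by \<open>2 ^ k\<close>, so their maximum is
  their limit.\<close>

definition limit :: "nat \<Rightarrow> nat" where
  "limit k = Max (approx k ` {k..})"

lemma finite_approx: "finite (approx k ` {k..})"
  by (rule finite_subset[of _ "{..<2 ^ k}"]) (auto simp: approx_less)

lemma approx_le_limit: "k \<le> n \<Longrightarrow> approx k n \<le> limit k"
  unfolding limit_def using finite_approx by (intro Max_ge) auto

lemma limit_stage: "\<exists>N\<ge>k. \<forall>n\<ge>N. approx k n = limit k"
proof -
  have "limit k \<in> approx k ` {k..}" unfolding limit_def using finite_approx by (intro Max_in) auto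
  then obtain N where N: "N \<ge> k" "approx k N = limit k" by auto
  have "approx k n = limit k" if "n \<ge> N" for n
    using approx_mono[OF N(1) that] approx_le_limit[of k n] N that by linarith
  then show ?thesis using N(1) by blast
qed

lemma limit_div: "m \<le> k \<Longrightarrow> limit k div 2 ^ (k - m) = limit m"
proof -
  assume "m \<le> k"
  obtain N M where "N \<ge> k" "\<And>n. n \<ge> N \<Longrightarrow> approx k n = limit k" "\<And>n. n \<ge> M \<Longrightarrow> approx m n = limit m"
    using limit_stage[of k] limit_stage[of m] by blast
  then show ?thesis using approx_div[OF \<open>m \<le> k\<close>, of "max M N"] by simp
qed

definition random_real :: cantor where
  "random_real i = odd (limit (Suc i))"

lemma pre_random_real: "pre random_real n = bits n (limit n)"
  by (rule nth_equalityI) (simp_all add: pre_def random_real_def bits_def limit_div)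

text \<open>If \<open>random_real\<close> were in all components of the test with index \<open>e\<close>, then some prefix of it would be enumerated and hence be
  covered. But eventually the leftmost uncovered strings extend this prefix.\<close>

theorem ml_random_random_real: "ml_random random_real"
  unfolding ml_random_def
proof (intro allI impI notI, elim conjE)
  fix U assume U: "uniformly_effectively_open U" and bound: "\<forall>i. measure cantor_measure (U i) \<le> 1 / 2 ^ i"
    and "random_real \<in> (\<Inter>i. U i)"
  obtain W where W: "ce (encode ` W)" "\<And>i. U i = {x. \<exists>\<sigma>. (i, \<sigma>) \<in> W \<and> initial_segment \<sigma> x}"
    using U unfolding uniformly_effectively_open_def encode_pair_eq by blast
  obtain e where "encode ` W = {n. \<exists>t. halts e n t}" using ce_halts[OF W(1)] by blast
  then have e: "p \<in> W \<longleftrightarrow> (\<exists>t. halts e (encode p) t)" for p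
    using inj_image_mem_iff[OF inj_encode, of p W] by simp
  have small: "small e n" for n
  proof -
    define S where "S = {v. v < 2 ^ n \<and> enumerated e (bits n v)}"
    have "card (bits n ` S) = card S"
      using inj_on_bits[of n] by (intro card_image) (auto simp: S_def elim: inj_on_subset)
    then have "card S / 2 ^ n = measure cantor_measure (\<Union>\<sigma>\<in>bits n ` S. cylinder \<sigma>)"
      by (subst measure_Union_cylinders[of _ n]) auto
    also have "\<dots> \<le> measure cantor_measure (U (e + 2))"
    proof (rule cantor.finite_measure_mono)
      have "U (e + 2) = (\<Union>\<sigma>\<in>{\<sigma>. (e + 2, \<sigma>) \<in> W}. cylinder \<sigma>)" by (auto simp: W(2) cylinder_def)
      then show "U (e + 2) \<in> sets cantor_measure" by (simp only: Union_cylinders_measurable)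
      show "(\<Union>\<sigma>\<in>bits n ` S. cylinder \<sigma>) \<subseteq> U (e + 2)"
      proof
        fix x assume "x \<in> (\<Union>\<sigma>\<in>bits n ` S. cylinder \<sigma>)"
        then have "enumerated e (pre x n)"
          by (auto simp: S_def cylinder_def initial_segment_iff)
        then obtain m where "m \<le> n" "(e + 2, pre x m) \<in> W"
          unfolding enumerated_def e length_pre by (metis take_pre)
        moreover have "initial_segment (pre x m) x" by (simp add: initial_segment_iff)
        ultimately show "x \<in> U (e + 2)" unfolding W(2) by blast
      qed
    qed
    also have "\<dots> \<le> 1 / 2 ^ (e + 2)" using bound by blast
    finally have "real (card S * 2 ^ (e + 2)) \<le> real (2 ^ n)" by (simp add: field_simps)
    then show ?thesis unfolding small_def S_def of_nat_le_iff .
  qed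
  have "random_real \<in> U (e + 2)" using \<open>random_real \<in> (\<Inter>i. U i)\<close> by blast
  then obtain \<sigma> t where \<sigma>: "halts e (encode (e + 2, \<sigma>)) t" "pre random_real (length \<sigma>) = \<sigma>"
    by (auto simp: W(2) e initial_segment_iff)
  define n where "n = max (length \<sigma>) (max t e)"
  have "take (length \<sigma>) (pre random_real n) = \<sigma>" using \<sigma>(2) by (simp add: take_pre n_def)
  then have "enumerated e (pre random_real n)"
    unfolding enumerated_def using halts_mono[OF \<sigma>(1), of n]
    by (intro exI[of _ "length \<sigma>"]) (simp add: n_def)
  moreover have "e \<le> n" by (simp add: n_def)
  ultimately have cov: "covered n (limit n)"
    unfolding covered_def using small by (intro exI[of _ n] exI[of _ e] conjI) (simp_all add: pre_random_real)
  obtain N where "N \<ge> n" "approx n N = limit n" using limit_stage by blast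
  then have "covered N (leftmost N)" using cov by (metis approx_def covered_extend)
  then show False using leftmost_not_covered by blast
qed

section \<open>The random real is not computable\<close>

lemma recursive_pre [recursive_intros]:
  assumes "recursive n" "recursive (\<lambda>p. f (fst p) (snd p))"
  shows "recursive (\<lambda>x. pre (f x) (n x))"
  unfolding pre_def by (intro recursive_intros assms)

lemma computable_real_iff_recursive: "computable_real x \<longleftrightarrow> recursive x"
  unfolding computable_real_def computable_iff_recursive
  by (auto elim!: recursive_recode)

text \<open>The cylinders around the prefixes of a computable real form a Martin-Loef test.\<close>

lemma ml_random_not_computable:
  assumes "ml_random x" shows "\<not> computable_real x"
proof
  assume "computable_real x"
  then have "recursive x" unfolding computable_real_iff_recursive .
  note x = recursive_comp[OF this]
  have "recursive (\<lambda>i. (i, pre x i))"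
    by (intro recursive_intros x)
  then have "ce (encode ` {(i, pre x i) | i. True})"
    by (rule ce_encode_image) (rule recursive_const)
  then have "uniformly_effectively_open (\<lambda>i. cylinder (pre x i))"
    unfolding uniformly_effectively_open_def encode_pair_eq
    by (intro exI[of _ "{(i, pre x i) | i. True}"]) (auto simp: cylinder_def)
  then have "x \<notin> (\<Inter>i. cylinder (pre x i))"
    using assms unfolding ml_random_def by (simp add: measure_cylinder)
  then show False by (simp add: cylinder_def initial_segment_iff)
qed

definition stage :: "nat \<Rightarrow> bool list" where
  "stage s = bits s (leftmost s)"

text \<open>Because the approximations come from the left, a prefix that is correct at some stage remains correct.\<close>

definition settled :: "nat \<Rightarrow> nat \<Rightarrow> bool" where
  "settled k s \<longleftrightarrow> take k (stage s) = pre random_real k"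

lemma recursive_stage [recursive_intros]: "recursive s \<Longrightarrow> recursive (\<lambda>x. stage (s x))"
  unfolding stage_def by (intro recursive_intros)

lemma limit_less: "limit k < 2 ^ k"
  using limit_stage[of k] approx_less[of k] by (metis order_refl)

lemma settled_iff: "settled k s \<longleftrightarrow> k \<le> s \<and> approx k s = limit k"
proof (cases "k \<le> s")
  case True
  have "settled k s \<longleftrightarrow> bits k (approx k s) = bits k (limit k)"
    using True by (simp add: settled_def stage_def bits_approx[symmetric] pre_random_real)
  also have "\<dots> \<longleftrightarrow> approx k s = limit k"
    using inj_on_bits[of k] approx_less[OF True] limit_less[of k] by (auto dest: inj_onD)
  finally show ?thesis using True by simp
next
  case False
  then have "length (take k (stage s)) \<noteq> length (pre random_real k)" by (simp add: stage_def)
  then show ?thesis using False unfolding settled_def by metis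
qed

lemma settled_mono: "settled k s \<Longrightarrow> s \<le> t \<Longrightarrow> settled k t"
  using approx_mono[of k s t] approx_le_limit[of k t] by (simp add: settled_iff)

lemma settled_antimono:
  assumes "settled k s" "j \<le> k" shows "settled j s"
proof -
  have "take j (take k (stage s)) = take j (pre random_real k)"
    using assms(1) by (simp add: settled_def)
  then show ?thesis using assms(2) by (simp add: settled_def take_pre min.absorb1)
qed

lemma ex_settled: "\<exists>s. settled k s"
  using limit_stage[of k] by (auto simp: settled_iff)

text \<open>A recursive bound on settling, for all but finitely many \<open>k\<close>, would make \<open>random_real\<close> computable: read bit \<open>n\<close> off
  the stage at which the first \<open>n + i + 1\<close> bits have settled.\<close>

lemma not_settled_recursively:
  assumes "recursive g" shows "\<exists>k>i. \<not> settled k (g k)"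
proof (rule ccontr)
  assume "\<not> ?thesis"
  then have g: "settled k (g k)" if "k > i" for k using that by blast
  have "random_real n = odd (leftmost (g (Suc (n + i))) div 2 ^ (g (Suc (n + i)) - Suc n))" for n
    using settled_antimono[OF g[of "Suc (n + i)"], of "Suc n"]
    by (simp add: settled_iff approx_def random_real_def)
  moreover have "recursive (\<lambda>n. odd (leftmost (g (Suc (n + i))) div 2 ^ (g (Suc (n + i)) - Suc n)))"
    by (intro recursive_intros recursive_comp[OF assms])
  ultimately have "computable_real random_real"
    unfolding computable_real_iff_recursive by presburger
  then show False using ml_random_not_computable ml_random_random_real by blast
qed

section \<open>The real of settled stages\<close>

text \<open>Only the first \<open>n\<close> bits of \<open>x\<close> matter at a pair \<open>(n, s)\<close>, and \<open>n\<close> is at most the code of the pair. For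
  \<open>s < n\<close> the stage string is too short, and the value is false.\<close>

definition agreement :: "cantor \<Rightarrow> cantor" where
  "agreement x m = (take (fst (prod_decode m)) (stage (snd (prod_decode m))) = pre x (fst (prod_decode m)))"

text \<open>The version for a finite string answers false whenever the string is too short to decide the
  question. For infinitely many prefixes of \<open>random_real\<close> this default turns out to be the correct answer far beyond
  the length of the prefix.\<close>

definition agreement_string :: "bool list \<Rightarrow> cantor" where
  "agreement_string \<sigma> m = (fst (prod_decode m) \<le> length \<sigma> \<and>
     take (fst (prod_decode m)) (stage (snd (prod_decode m))) = take (fst (prod_decode m)) \<sigma>)"

lemma recursive_agreement_string [recursive_intros]:
  assumes "recursive \<sigma>" "recursive m" shows "recursive (\<lambda>x. agreement_string (\<sigma> x) (m x))"
  unfolding agreement_string_def by (intro recursive_intros assms)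

lemma fst_prod_decode_le: "fst (prod_decode m) \<le> m"
  by (metis le_prod_encode_1 prod.collapse prod_decode_inverse)

lemma snd_prod_decode_le: "snd (prod_decode m) \<le> m"
  by (metis le_prod_encode_2 prod.collapse prod_decode_inverse)

lemma agreement_string_pre:
  "agreement_string (pre x k) m \<longleftrightarrow> fst (prod_decode m) \<le> k \<and> agreement x m"
  by (auto simp: agreement_string_def agreement_def take_pre)

lemma pre_agreement: "pre (agreement_string (pre x k)) k = pre (agreement x) k"
proof -
  have "fst (prod_decode m) \<le> k" if "m < k" for m
    using fst_prod_decode_le[of m] that by simp
  then have "agreement_string (pre x k) m = agreement x m" if "m < k" for m
    using that by (simp add: agreement_string_pre)
  then show ?thesis unfolding pre_def[of _ k] by (intro map_cong refl) simp
qed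

lemma agreement_random_real:
  "agreement random_real m = settled (fst (prod_decode m)) (snd (prod_decode m))"
  by (simp add: agreement_def settled_def)

text \<open>If the first \<open>k\<close> bits settle late, then so do all longer prefixes, and
  the questions about them that are coded by small numbers, which concern early stages, have the answer false.\<close>

lemma agreement_string_random_real:
  assumes "\<not> settled k (k + l)" "m < l"
  shows "agreement_string (pre random_real k) m = agreement random_real m"
proof -
  have "fst (prod_decode m) \<le> k" if "agreement random_real m"
  proof (rule ccontr)
    assume "\<not> fst (prod_decode m) \<le> k"
    then have "settled k (snd (prod_decode m))"
      using that settled_antimono unfolding agreement_random_real by simp
    then show False
      using assms settled_mono[of k "snd (prod_decode m)" "k + l"] snd_prod_decode_le[of m] by simp
  qed
  then show ?thesis by (auto simp: agreement_string_pre)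
qed

text \<open>From \<open>agreement random_real\<close> a settled stage can be found for every \<open>k\<close> by search, which no recursive function
  can do.\<close>

lemma agreement_not_computable: "\<not> computable_real (agreement random_real)"
proof
  assume "computable_real (agreement random_real)"
  then have "recursive (agreement random_real)" unfolding computable_real_iff_recursive .
  note comp = recursive_comp[OF this]
  have "recursive (\<lambda>p :: nat \<times> nat. agreement random_real (encode p))" by (intro recursive_intros comp)
  then have "recursive (\<lambda>p. settled (fst p) (snd p))"
    by (simp add: agreement_random_real encode_prod_def)
  then have "recursive (\<lambda>k. LEAST s. settled k s)"
    by (intro recursive_Least ex_settled)
  from not_settled_recursively[OF this, of 0] show False
    using LeastI_ex[OF ex_settled] by blast
qed

text \<open>Effective enumerations of the tuples that parametrize a c.e. set; repetitions are allowed.\<close>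

definition rec_enumeration :: "(nat \<Rightarrow> 'a::encodable) \<Rightarrow> bool" where
  "rec_enumeration D \<longleftrightarrow> recursive D \<and> surj D"

lemma rec_enumeration_nat: "rec_enumeration (\<lambda>n :: nat. n)"
  by (auto simp: rec_enumeration_def intro: recursive_intros)

lemma rec_enumeration_string: "rec_enumeration (\<lambda>n. map odd (list_decode n))"
proof -
  have "\<sigma> = map odd (list_decode (list_encode (map of_bool \<sigma>)))" for \<sigma> :: "bool list"
    by (simp add: comp_def map_idI)
  then have "surj (\<lambda>n. map odd (list_decode n))" by (rule surjI[OF sym])
  then show ?thesis unfolding rec_enumeration_def by (intro conjI recursive_intros)
qed

lemma rec_enumeration_pair:
  assumes "rec_enumeration D" "rec_enumeration E"
  shows "rec_enumeration (\<lambda>n. (D (fst (prod_decode n)), E (snd (prod_decode n))))"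
proof -
  have "surj (\<lambda>n. (D (fst (prod_decode n)), E (snd (prod_decode n))))"
  proof (rule surjI)
    fix p
    show "(D (fst (prod_decode (prod_encode (inv D (fst p), inv E (snd p))))),
      E (snd (prod_decode (prod_encode (inv D (fst p), inv E (snd p)))))) = p"
      using assms by (simp add: rec_enumeration_def surj_f_inv_f)
  qed
  moreover have "recursive D" "recursive E" using assms unfolding rec_enumeration_def by auto
  note DE = recursive_comp[OF this(1)] recursive_comp[OF this(2)]
  have "recursive (\<lambda>n. (D (fst (prod_decode n)), E (snd (prod_decode n))))"
    by (intro recursive_intros DE)
  ultimately show ?thesis unfolding rec_enumeration_def by blast
qed

lemma ce_encode_image_enumeration:
  fixes f :: "'a::encodable \<Rightarrow> 'b::encodable"
  assumes "rec_enumeration (D :: nat \<Rightarrow> 'a)" "recursive f" "recursive P"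
  shows "ce (encode ` {f p | p. P (p :: 'a)})"
proof -
  have "{f p | p. P p} = {f (D n) | n. P (D n)}"
    using assms(1) unfolding rec_enumeration_def by (metis (no_types, opaque_lifting) surjD)
  then show ?thesis
    using ce_encode_image[OF recursive_comp[OF assms(2)] recursive_comp[OF assms(3)], of D D] assms(1)
    by (simp add: rec_enumeration_def)
qed

lemma agreement_tt_reducible: "agreement x \<le>\<^sub>t\<^sub>t x"
proof -
  define out where "out \<sigma> = pre (agreement_string \<sigma>) (length \<sigma>)" for \<sigma>
  define \<Phi> where "\<Phi> = {(\<sigma>, out \<sigma>) | \<sigma>. True}"
  have "recursive (\<lambda>\<sigma>. (\<sigma>, out \<sigma>))"
    unfolding out_def by (intro recursive_intros)
  then have "ce (encode ` \<Phi>)"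
    unfolding \<Phi>_def by (intro ce_encode_image_enumeration[OF rec_enumeration_string] recursive_const)
  moreover have "prefix (out \<sigma>) (out \<sigma>')" if "prefix \<sigma> \<sigma>'" for \<sigma> \<sigma>'
  proof -
    obtain \<rho> where \<rho>: "\<sigma>' = \<sigma> @ \<rho>" using \<open>prefix \<sigma> \<sigma>'\<close> by (auto elim: prefixE)
    have "agreement_string \<sigma>' m = agreement_string \<sigma> m" if "m < length \<sigma>" for m
      using that fst_prod_decode_le[of m] by (simp add: agreement_string_def \<rho>)
    then have "out \<sigma> = take (length \<sigma>) (out \<sigma>')"
      unfolding out_def by (simp add: take_pre \<rho>) (simp add: pre_def)
    then show ?thesis by (metis take_is_prefix)
  qed
  ultimately have "turing_functional \<Phi>"
    unfolding turing_functional_def encode_strings_eq \<Phi>_def by auto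
  moreover have "functional_value \<Phi> z (agreement z)" for z
    unfolding functional_value_def
  proof
    fix n
    have "(pre z (Suc n), pre (agreement z) (Suc n)) \<in> \<Phi>"
      unfolding \<Phi>_def out_def using pre_agreement[of z "Suc n"] by auto
    then show "\<exists>(\<sigma>, \<tau>)\<in>\<Phi>. initial_segment \<sigma> z \<and> initial_segment \<tau> (agreement z) \<and> n < length \<tau>"
      by (rule bexI[rotated]) (simp add: initial_segment_iff)
  qed
  ultimately show ?thesis unfolding tt_reducible_def by blast
qed

section \<open>No random real is weak truth-table below the real of settled stages\<close>

lemma take_prefix_eq: "prefix \<sigma> \<tau> \<Longrightarrow> n \<le> length \<sigma> \<Longrightarrow> take n \<sigma> = take n \<tau>"
  by (auto elim: prefixE)

text \<open>The axioms that apply to one real have comparable oracle strings, and so comparable outputs.\<close>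

lemma functional_consistent:
  assumes "turing_functional \<Phi>" "(\<sigma>, \<tau>) \<in> \<Phi>" "(\<sigma>', \<tau>') \<in> \<Phi>"
    "initial_segment \<sigma> x" "initial_segment \<sigma>' x" "n \<le> length \<tau>" "n \<le> length \<tau>'"
  shows "take n \<tau> = take n \<tau>'"
proof -
  have *: "prefix \<sigma> \<sigma>' \<or> prefix \<sigma>' \<sigma>"
    using assms(4,5) unfolding initial_segment_iff by (metis linear take_is_prefix take_pre)
  have "prefix \<tau> \<tau>' \<or> prefix \<tau>' \<tau>"
    using * assms(1-3) unfolding turing_functional_def by fast
  then show ?thesis using take_prefix_eq assms(6,7) by metis
qed

text \<open>The string \<open>\<sigma>\<close> is a guess of the first \<open>k\<close> bits of \<open>random_real\<close>. Its answers replace the oracle up to the bound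
  \<open>h (2 * k)\<close> on the use, and \<open>\<rho>\<close> consists of the \<open>2 * k\<close> bits of output that are obtained in this way.\<close>

definition guess :: "(bool list \<times> bool list) set \<Rightarrow> (nat \<Rightarrow> nat) \<Rightarrow> bool list \<Rightarrow> bool list \<Rightarrow> bool" where
  "guess \<Phi> h \<sigma> \<rho> \<longleftrightarrow> (\<exists>(\<sigma>', \<tau>)\<in>\<Phi>. length \<sigma>' \<le> h (2 * length \<sigma>) \<and> initial_segment \<sigma>' (agreement_string \<sigma>) \<and>
     2 * length \<sigma> < length \<tau> \<and> \<rho> = take (2 * length \<sigma>) \<tau>)"

lemma guess_unique:
  assumes "turing_functional \<Phi>" "guess \<Phi> h \<sigma> \<rho>" "guess \<Phi> h \<sigma> \<rho>'"
  shows "\<rho> = \<rho>'"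
proof -
  obtain \<sigma>1 \<tau>1 \<sigma>2 \<tau>2 where "(\<sigma>1, \<tau>1) \<in> \<Phi>" "initial_segment \<sigma>1 (agreement_string \<sigma>)"
      "2 * length \<sigma> < length \<tau>1" "\<rho> = take (2 * length \<sigma>) \<tau>1"
      "(\<sigma>2, \<tau>2) \<in> \<Phi>" "initial_segment \<sigma>2 (agreement_string \<sigma>)"
      "2 * length \<sigma> < length \<tau>2" "\<rho>' = take (2 * length \<sigma>) \<tau>2"
    using assms(2,3) unfolding guess_def by blast
  then show ?thesis using functional_consistent[OF assms(1)] by (metis less_imp_le)
qed

lemma length_guess: "guess \<Phi> h \<sigma> \<rho> \<Longrightarrow> length \<rho> = 2 * length \<sigma>"
  by (auto simp: guess_def)

definition guessed_set :: "(bool list \<times> bool list) set \<Rightarrow> (nat \<Rightarrow> nat) \<Rightarrow> nat \<Rightarrow> cantor set" where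
  "guessed_set \<Phi> h k = (\<Union>\<rho>\<in>{\<rho>. \<exists>\<sigma>. length \<sigma> = k \<and> guess \<Phi> h \<sigma> \<rho>}. cylinder \<rho>)"

text \<open>Each of the \<open>2 ^ k\<close> guesses determines at most one string of length \<open>2 * k\<close>.\<close>

lemma measure_guessed_set:
  assumes "turing_functional \<Phi>"
  shows "measure cantor_measure (guessed_set \<Phi> h k) \<le> 1 / 2 ^ k"
proof -
  let ?S = "{\<rho>. \<exists>\<sigma>. length \<sigma> = k \<and> guess \<Phi> h \<sigma> \<rho>}"
  have "?S \<subseteq> (\<lambda>\<sigma>. THE \<rho>. guess \<Phi> h \<sigma> \<rho>) ` {\<sigma>. length \<sigma> = k}"
  proof
    fix \<rho> assume "\<rho> \<in> ?S"
    then obtain \<sigma> where \<sigma>: "length \<sigma> = k" "guess \<Phi> h \<sigma> \<rho>" by blast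
    then have "(THE \<rho>. guess \<Phi> h \<sigma> \<rho>) = \<rho>"
      using guess_unique[OF assms] by (intro the_equality) auto
    then show "\<rho> \<in> (\<lambda>\<sigma>. THE \<rho>. guess \<Phi> h \<sigma> \<rho>) ` {\<sigma>. length \<sigma> = k}" using \<sigma>(1) by force
  qed
  then have "card ?S \<le> card ((\<lambda>\<sigma>. THE \<rho>. guess \<Phi> h \<sigma> \<rho>) ` {\<sigma>. length \<sigma> = k})"
    using finite_strings[of k] by (intro card_mono) auto
  also have "\<dots> \<le> 2 ^ k"
    using card_image_le[OF finite_strings[of k]] by (simp add: card_strings)
  finally have card: "real (card ?S) \<le> 2 ^ k" by (simp flip: of_nat_le_iff)
  have "measure cantor_measure (guessed_set \<Phi> h k) = card ?S / 2 ^ (2 * k)"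
    unfolding guessed_set_def by (rule measure_Union_cylinders) (auto dest: length_guess)
  also have "\<dots> \<le> 2 ^ k / 2 ^ (2 * k)" using card by (intro divide_right_mono) auto
  also have "\<dots> = 1 / 2 ^ k" by (simp add: mult_2 power_add)
  finally show ?thesis .
qed

lemma guessed_set_measurable: "guessed_set \<Phi> h k \<in> sets cantor_measure"
  unfolding guessed_set_def by (rule Union_cylinders_measurable)

text \<open>The component of the test with index \<open>i\<close> is the union of the guessed sets for \<open>k > i\<close>, whose measures
  are bounded by a geometric series.\<close>

lemma measure_guessed_tail:
  assumes "turing_functional \<Phi>"
  shows "measure cantor_measure (\<Union>j. guessed_set \<Phi> h (Suc (i + j))) \<le> 1 / 2 ^ i"
proof -
  have sums: "(\<lambda>j. 1 / 2 ^ Suc (i + j)) sums (1 / 2 ^ i :: real)"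
  proof -
    have "(\<lambda>j. 1 / 2 ^ Suc i * (1 / 2) ^ j) sums (1 / 2 ^ Suc i * (1 / (1 - 1 / 2)) :: real)"
      by (intro sums_mult geometric_sums) simp
    then show ?thesis by (simp add: power_add power_one_over mult_ac)
  qed
  have le: "measure cantor_measure (guessed_set \<Phi> h (Suc (i + j))) \<le> 1 / 2 ^ Suc (i + j)" for j
    by (rule measure_guessed_set[OF assms])
  have summable: "summable (\<lambda>j. measure cantor_measure (guessed_set \<Phi> h (Suc (i + j))))"
    by (rule summable_comparison_test'[OF sums_summable[OF sums], of 0]) (use le in simp)
  have "measure cantor_measure (\<Union>j. guessed_set \<Phi> h (Suc (i + j))) \<le>
      (\<Sum>j. measure cantor_measure (guessed_set \<Phi> h (Suc (i + j))))"
    using summable guessed_set_measurable by (intro cantor.finite_measure_subadditive_countably) auto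
  also have "\<dots> \<le> (\<Sum>j. 1 / 2 ^ Suc (i + j))"
    by (intro suminf_le le summable sums_summable[OF sums])
  also have "\<dots> = 1 / 2 ^ i" using sums by (rule sums_unique[symmetric])
  finally show ?thesis .
qed

lemma guessed_tail_effectively_open:
  assumes "turing_functional \<Phi>" "recursive h"
  shows "uniformly_effectively_open (\<lambda>i. \<Union>j. guessed_set \<Phi> h (Suc (i + j)))"
proof -
  have "ce (encode ` \<Phi>)" using assms(1) unfolding turing_functional_def encode_strings_eq by blast
  then obtain e where "encode ` \<Phi> = {n. \<exists>t. halts e n t}" using ce_halts by blast
  then have e: "p \<in> \<Phi> \<longleftrightarrow> (\<exists>t. halts e (encode p) t)" for p
    using inj_image_mem_iff[OF inj_encode, of p \<Phi>] by simp
  \<comment> \<open>The parameters are the index \<open>i\<close> of the component, the guess \<open>\<sigma>\<close>, an axiom \<open>(\<sigma>', \<tau>)\<close> of the functional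
    and a number \<open>t\<close> of steps after which this axiom has been enumerated.\<close>
  define P where "P = (\<lambda>(i, \<sigma>, \<sigma>', \<tau>, t). i < length \<sigma> \<and> halts e (encode (\<sigma>' :: bool list, \<tau> :: bool list)) t \<and>
    length \<sigma>' \<le> h (2 * length \<sigma>) \<and> pre (agreement_string \<sigma>) (length \<sigma>') = \<sigma>' \<and> 2 * length \<sigma> < length \<tau>)"
  define f where "f = (\<lambda>(i :: nat, \<sigma> :: bool list, \<sigma>' :: bool list, \<tau> :: bool list, t :: nat). (i, take (2 * length \<sigma>) \<tau>))"
  define W where "W = {f p | p. P p}"
  have "ce (encode ` W)"
    unfolding W_def
  proof (rule ce_encode_image_enumeration[OF rec_enumeration_pair[OF rec_enumeration_nat
        rec_enumeration_pair[OF rec_enumeration_string rec_enumeration_pair[OF rec_enumeration_string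
        rec_enumeration_pair[OF rec_enumeration_string rec_enumeration_nat]]]]])
    show "recursive f" unfolding f_def split_def by (intro recursive_intros)
    show "recursive P" unfolding P_def split_def
      by (intro recursive_intros recursive_comp[OF assms(2)])
  qed
  moreover have "(i, \<rho>) \<in> W \<longleftrightarrow> (\<exists>\<sigma>. i < length \<sigma> \<and> guess \<Phi> h \<sigma> \<rho>)" for i \<rho>
  proof -
    have "(i, \<rho>) \<in> W \<longleftrightarrow> (\<exists>\<sigma> \<sigma>' \<tau> t. P (i, \<sigma>, \<sigma>', \<tau>, t) \<and> \<rho> = take (2 * length \<sigma>) \<tau>)"
      unfolding W_def f_def mem_Collect_eq split_paired_Ex prod.case prod.inject by blast
    moreover have "guess \<Phi> h \<sigma> \<rho> \<longleftrightarrow> (\<exists>\<sigma>' \<tau> t. halts e (encode (\<sigma>', \<tau>)) t \<and> length \<sigma>' \<le> h (2 * length \<sigma>) \<and>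
        pre (agreement_string \<sigma>) (length \<sigma>') = \<sigma>' \<and> 2 * length \<sigma> < length \<tau> \<and> \<rho> = take (2 * length \<sigma>) \<tau>)" for \<sigma>
      unfolding guess_def Bex_def split_paired_Ex prod.case e initial_segment_iff by blast
    ultimately show ?thesis unfolding P_def prod.case by blast
  qed
  moreover have "(\<exists>\<sigma>. i < length \<sigma> \<and> guess \<Phi> h \<sigma> \<rho>) \<longleftrightarrow> (\<exists>j \<sigma>. length \<sigma> = Suc (i + j) \<and> guess \<Phi> h \<sigma> \<rho>)" for i \<rho>
    by (metis less_add_Suc1 less_iff_Suc_add)
  ultimately show ?thesis
    unfolding uniformly_effectively_open_def encode_pair_eq
    by (intro exI[of _ W]) (auto simp: guessed_set_def cylinder_def)
qed

text \<open>If the first \<open>k\<close> bits settle late, then the correct guess reproduces all answers of the oracle within the use, and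
  so the functional yields the first \<open>2 * k\<close> bits of \<open>y\<close>.\<close>

lemma in_guessed_set:
  assumes "turing_functional \<Phi>" and computes: "functional_value \<Phi> (agreement random_real) y"
    and bound: "\<forall>n. use \<Phi> (agreement random_real) n \<le> h n"
    and unsettled: "\<not> settled k (k + h (2 * k))"
  shows "y \<in> guessed_set \<Phi> h k"
proof -
  let ?b = "agreement random_real"
  obtain \<sigma>1 \<tau>1 where 1: "(\<sigma>1, \<tau>1) \<in> \<Phi>" "initial_segment \<sigma>1 ?b" "initial_segment \<tau>1 y" "2 * k < length \<tau>1"
    using computes unfolding functional_value_def by blast
  then have "\<exists>l. \<exists>(\<sigma>, \<tau>)\<in>\<Phi>. initial_segment \<sigma> ?b \<and> 2 * k < length \<tau> \<and> length \<sigma> = l" by blast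
  from LeastI_ex[OF this] obtain \<sigma> \<tau> where 2: "(\<sigma>, \<tau>) \<in> \<Phi>" "initial_segment \<sigma> ?b" "2 * k < length \<tau>"
    "length \<sigma> = use \<Phi> ?b (2 * k)"
    unfolding use_def by blast
  have len: "length \<sigma> \<le> h (2 * k)" using 2(4) bound by simp
  have "initial_segment \<sigma> (agreement_string (pre random_real k))"
    using 2(2) len agreement_string_random_real[OF unsettled] by (auto simp: initial_segment_def)
  then have "guess \<Phi> h (pre random_real k) (take (2 * k) \<tau>)"
    unfolding guess_def using 2 len by (intro bexI[of _ "(\<sigma>, \<tau>)"]) auto
  moreover have "take (2 * k) \<tau> = pre y (2 * k)"
  proof -
    have "take (2 * k) \<tau> = take (2 * k) \<tau>1"
      using functional_consistent[OF assms(1) 2(1) 1(1) 2(2) 1(2), of "2 * k"] 1(4) 2(3) by simp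
    also have "\<tau>1 = pre y (length \<tau>1)" using 1(3) by (simp add: initial_segment_iff)
    finally show ?thesis using 1(4) by (simp add: take_pre)
  qed
  moreover have "y \<in> cylinder (pre y (2 * k))" by (simp add: cylinder_def initial_segment_iff)
  ultimately show ?thesis unfolding guessed_set_def using length_pre by force
qed

lemma no_random_wtt_below_agreement:
  assumes "y \<le>\<^sub>w\<^sub>t\<^sub>t agreement random_real" shows "\<not> ml_random y"
proof
  assume y: "ml_random y"
  obtain \<Phi> h where \<Phi>: "turing_functional \<Phi>" "functional_value \<Phi> (agreement random_real) y"
    "\<forall>n. use \<Phi> (agreement random_real) n \<le> h n" and h: "recursive h"
    using assms unfolding wtt_reducible_def computable_iff_recursive by blast
  have "y \<in> (\<Union>j. guessed_set \<Phi> h (Suc (i + j)))" for i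
  proof -
    have "recursive (\<lambda>k. k + h (2 * k))" by (intro recursive_intros recursive_comp[OF h])
    from not_settled_recursively[OF this, of i] obtain k where "k > i" "\<not> settled k (k + h (2 * k))" by blast
    moreover obtain j where "k = Suc (i + j)" using \<open>k > i\<close> less_iff_Suc_add by auto
    ultimately have "y \<in> guessed_set \<Phi> h (Suc (i + j))" using in_guessed_set[OF \<Phi>] by blast
    then show ?thesis by blast
  qed
  then show False
    using y guessed_tail_effectively_open[OF \<Phi>(1) h] measure_guessed_tail[OF \<Phi>(1)]
    unfolding ml_random_def by blast
qed

theorem corollary5p5:
  "\<exists>a b. ml_random a \<and> \<not> computable_real b \<and> b \<le>\<^sub>t\<^sub>t a \<and>
     \<not> (\<exists>y. ml_random y \<and> y \<le>\<^sub>w\<^sub>t\<^sub>t b)"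
  using ml_random_random_real agreement_not_computable agreement_tt_reducible
    no_random_wtt_below_agreement by blast

end
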